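(* Let $Q>0$ and $N>0$. For every $P\ge 0$, the optimal Gaussian estimation cost $S_{\mathsf G}(P)$ for the Witsenhausen problem with causal encoder and non-causal decoder (defined in the context as an infimum over jointly Gaussian distributions) is given by $$S_{\mathsf G}(P)=\begin{cases}\dfrac{N\,(Q-N-P)}{Q} & \text{if } Q>4N \text{ and } P\in[P_1,P_2],\\[2mm] S_\ell(P) & \text{otherwise,}\end{cases}$$ where $$P_1=\tfrac12\left(Q-2N-\sqrt{Q^2-4QN}\right),\qquad P_2=\tfrac12\left(Q-2N+\sqrt{Q^2-4QN}\right),$$ and $$S_\ell(P)=\begin{cases}\dfrac{(\sqrt Q-\sqrt P)^2\, N}{(\sqrt Q-\sqrt P)^2+N} & \text{if } P\in[0,Q],\\[2mm] 0 & \text{otherwise.}\end{cases}$$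
   Context: Fix $Q,N>0$. Let $X_0\sim\mathcal N(0,Q)$ and $Z_1\sim\mathcal N(0,N)$. All random variables are real-valued. Given an input $U_1$, set $X_1=X_0+U_1$ and $Y_1=X_1+Z_1=X_0+U_1+Z_1$, where $Z_1$ is the channel noise; this defines the conditional law $\mathcal P_{X_1,Y_1|X_0,U_1}$. For $P\ge 0$, let $\mathbb P(P)$ be the set of tuples $(\mathcal P_{W_1},\mathcal P_{W_2|X_0,W_1},\mathcal P_{U_1|X_0,W_1},\mathcal P_{U_2|W_1,W_2,Y_1})$, where $W_1,W_2$ are auxiliary real random variables, such that under the joint distribution $$\mathcal P_{X_0}\,\mathcal P_{W_1}\,\mathcal P_{W_2|X_0,W_1}\,\mathcal P_{U_1|X_0,W_1}\,\mathcal P_{X_1,Y_1|X_0,U_1}\,\mathcal P_{U_2|W_1,W_2,Y_1}$$ the following hold: (i) $\mathbb E[U_1^2]=P$; (ii) $I(W_1,W_2;Y_1)-I(W_2;X_0\mid W_1)\ge 0$, where $I$ denotes (conditional) mutual information; (iii) $(X_0,W_1,W_2,U_1,X_1,Y_1,U_2)$ are jointly Gaussian (possibly degenerate, and not necessarily centered). In particular, under such a joint distribution: $X_0$ is independent of $W_1$; $U_1$ and $W_2$ are conditionally independent given $(X_0,W_1)$; $Z_1$ is independent of $(X_0,W_1,W_2,U_1)$; and $U_2$ is conditionally independent of $(X_0,U_1,X_1)$ given $(W_1,W_2,Y_1)$. The optimal Gaussian estimation cost is $$S_{\mathsf G}(P)=\inf_{\mathcal P\in\mathbb P(P)}\mathbb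 E\left[(X_1-U_2)^2\right].$$ *)

theory Defs
  imports "HOL-Probability.Probability"
begin

subsection \<open>Gaussian laws on Euclidean spaces\<close>

text \<open>The parameter is the variance, whereas \<^const>\<open>normal_density\<close> takes the standard deviation.\<close>

definition centered_normal :: "real \<Rightarrow> real measure" where
  "centered_normal v = density lborel (\<lambda>x. ennreal (normal_density 0 (sqrt v) x))"

definition std_gaussian :: "'a::euclidean_space measure" where
  "std_gaussian = density lborel (\<lambda>z. ennreal (\<Prod>b\<in>Basis. std_normal_density (z \<bullet> b)))"

text \<open>Law of \<open>m + A Z\<close> with \<open>Z\<close> standard Gaussian. The linear map \<open>A\<close> may be singular, so
  degenerate laws are included; a square \<open>A\<close> reaches every covariance matrix.\<close>

definition gaussian_law :: "'a::euclidean_space measure \<Rightarrow> bool" where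
  "gaussian_law J \<longleftrightarrow> (\<exists>m (A :: 'a \<Rightarrow> 'a). linear A \<and> J = distr std_gaussian borel (\<lambda>z. m + A z))"


subsection \<open>Mutual information with values in the extended reals\<close>

text \<open>The divergence of \<open>N\<close> from \<open>M\<close>, with the argument order of \<^const>\<open>KL_divergence\<close>. The
  real-valued \<^const>\<open>KL_divergence\<close> returns junk (typically 0) when \<open>N\<close> is not absolutely
  continuous with respect to \<open>M\<close> or the log-density is not integrable; the divergence is then
  infinite (for probability measures the negative part of the log-density is always integrable).\<close>

definition KL_divergence_ext :: "real \<Rightarrow> 'a measure \<Rightarrow> 'a measure \<Rightarrow> ereal" where
  "KL_divergence_ext b M N =
    (if absolutely_continuous M N \<and> integrable N (entropy_density b M N)
     then ereal (KL_divergence b M N) else \<infinity>)"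

definition mutual_info ::
  "real \<Rightarrow> 'a measure \<Rightarrow> 'b measure \<Rightarrow> 'c measure \<Rightarrow> ('a \<Rightarrow> 'b) \<Rightarrow> ('a \<Rightarrow> 'c) \<Rightarrow> ereal" where
  "mutual_info b M S T X Y =
    KL_divergence_ext b (distr M S X \<Otimes>\<^sub>M distr M T Y) (distr M (S \<Otimes>\<^sub>M T) (\<lambda>\<omega>. (X \<omega>, Y \<omega>)))"

text \<open>A regular conditional distribution of \<open>X\<close> given \<open>Z\<close>. It exists for standard Borel \<open>S\<close> (here
  always the real line) and is unique up to null sets of the law of \<open>Z\<close>.\<close>

definition is_cond_distr ::
  "'a measure \<Rightarrow> 'b measure \<Rightarrow> 'c measure \<Rightarrow> ('a \<Rightarrow> 'b) \<Rightarrow> ('a \<Rightarrow> 'c) \<Rightarrow> ('c \<Rightarrow> 'b measure) \<Rightarrow> bool"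
where
  "is_cond_distr M S T X Z K \<longleftrightarrow>
    K \<in> T \<rightarrow>\<^sub>M prob_algebra S \<and>
    distr M (T \<Otimes>\<^sub>M S) (\<lambda>\<omega>. (Z \<omega>, X \<omega>)) =
      distr M T Z \<bind> (\<lambda>z. K z \<bind> (\<lambda>x. return (T \<Otimes>\<^sub>M S) (z, x)))"

definition cond_distr ::
  "'a measure \<Rightarrow> 'b measure \<Rightarrow> 'c measure \<Rightarrow> ('a \<Rightarrow> 'b) \<Rightarrow> ('a \<Rightarrow> 'c) \<Rightarrow> 'c \<Rightarrow> 'b measure" where
  "cond_distr M S T X Z = (SOME K. is_cond_distr M S T X Z K)"

text \<open>\<open>I(X;Y|Z)\<close> as the divergence of the law of \<open>(Z,X,Y)\<close> from \<open>P\<^sub>Z P\<^sub>X\<^sub>|\<^sub>Z P\<^sub>Y\<^sub>|\<^sub>Z\<close>. The library's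
  \<open>conditional_mutual_information\<close> is a difference of real-valued mutual informations, which is
  meaningless when these are infinite (e.g. for \<open>X = Y\<close> continuous).\<close>

definition cond_mutual_info ::
  "real \<Rightarrow> 'a measure \<Rightarrow> 'b measure \<Rightarrow> 'c measure \<Rightarrow> 'd measure \<Rightarrow>
    ('a \<Rightarrow> 'b) \<Rightarrow> ('a \<Rightarrow> 'c) \<Rightarrow> ('a \<Rightarrow> 'd) \<Rightarrow> ereal" where
  "cond_mutual_info b M S T R X Y Z =
    KL_divergence_ext b
      (do { z \<leftarrow> distr M R Z;
            x \<leftarrow> cond_distr M S R X Z z;
            y \<leftarrow> cond_distr M T R Y Z z;
            return (R \<Otimes>\<^sub>M (S \<Otimes>\<^sub>M T)) (z, x, y) })
      (distr M (R \<Otimes>\<^sub>M (S \<Otimes>\<^sub>M T)) (\<lambda>\<omega>. (Z \<omega>, X \<omega>, Y \<omega>)))"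


subsection \<open>The Witsenhausen problem with causal encoder and non-causal decoder\<close>

definition channel :: "real \<Rightarrow> real \<times> real \<Rightarrow> (real \<times> real) measure" where
  "channel N = (\<lambda>(x0, u1). do {
     z1 \<leftarrow> centered_normal N;
     let x1 = x0 + u1;
     return borel (x1, x1 + z1) })"

type_synonym policy =
  "real measure \<times> (real \<times> real \<Rightarrow> real measure) \<times> (real \<times> real \<Rightarrow> real measure) \<times>
    (real \<times> real \<times> real \<Rightarrow> real measure)"

type_synonym outcome = "real \<times> real \<times> real \<times> real \<times> real \<times> real \<times> real"

text \<open>A policy is a tuple of a law and Markov kernels for \<open>W\<^sub>1\<close>, \<open>W\<^sub>2|X\<^sub>0,W\<^sub>1\<close>, \<open>U\<^sub>1|X\<^sub>0,W\<^sub>1\<close>,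
  \<open>U\<^sub>2|W\<^sub>1,W\<^sub>2,Y\<^sub>1\<close>; the outcome is \<open>(X\<^sub>0,W\<^sub>1,W\<^sub>2,U\<^sub>1,X\<^sub>1,Y\<^sub>1,U\<^sub>2)\<close>.\<close>

definition policies :: "policy set" where
  "policies = space (prob_algebra borel) \<times> (borel \<rightarrow>\<^sub>M prob_algebra borel) \<times>
     (borel \<rightarrow>\<^sub>M prob_algebra borel) \<times> (borel \<rightarrow>\<^sub>M prob_algebra borel)"

definition joint_law :: "real \<Rightarrow> real \<Rightarrow> policy \<Rightarrow> outcome measure" where
  "joint_law Q N = (\<lambda>(PW1, KW2, KU1, KU2). do {
     x0 \<leftarrow> centered_normal Q;
     w1 \<leftarrow> PW1;
     w2 \<leftarrow> KW2 (x0, w1);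
     u1 \<leftarrow> KU1 (x0, w1);
     (x1, y1) \<leftarrow> channel N (x0, u1);
     u2 \<leftarrow> KU2 (w1, w2, y1);
     return borel (x0, w1, w2, u1, x1, y1, u2) })"

definition X0 :: "outcome \<Rightarrow> real" where "X0 = (\<lambda>(x0, w1, w2, u1, x1, y1, u2). x0)"
definition W1 :: "outcome \<Rightarrow> real" where "W1 = (\<lambda>(x0, w1, w2, u1, x1, y1, u2). w1)"
definition W2 :: "outcome \<Rightarrow> real" where "W2 = (\<lambda>(x0, w1, w2, u1, x1, y1, u2). w2)"
definition U1 :: "outcome \<Rightarrow> real" where "U1 = (\<lambda>(x0, w1, w2, u1, x1, y1, u2). u1)"
definition X1 :: "outcome \<Rightarrow> real" where "X1 = (\<lambda>(x0, w1, w2, u1, x1, y1, u2). x1)"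
definition Y1 :: "outcome \<Rightarrow> real" where "Y1 = (\<lambda>(x0, w1, w2, u1, x1, y1, u2). y1)"
definition U2 :: "outcome \<Rightarrow> real" where "U2 = (\<lambda>(x0, w1, w2, u1, x1, y1, u2). u2)"

definition gaussian_policies :: "real \<Rightarrow> real \<Rightarrow> real \<Rightarrow> policy set" where
  "gaussian_policies Q N P = {p \<in> policies. let J = joint_law Q N p in
     (\<integral>\<omega>. (U1 \<omega>)\<^sup>2 \<partial>J) = P \<and>
     mutual_info 2 J (borel \<Otimes>\<^sub>M borel) borel (\<lambda>\<omega>. (W1 \<omega>, W2 \<omega>)) Y1
       - cond_mutual_info 2 J borel borel borel W2 X0 W1 \<ge> 0 \<and>
     gaussian_law J}"

definition S_G :: "real \<Rightarrow> real \<Rightarrow> real \<Rightarrow> real" where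
  "S_G Q N P = (INF p\<in>gaussian_policies Q N P. \<integral>\<omega>. (X1 \<omega> - U2 \<omega>)\<^sup>2 \<partial>joint_law Q N p)"

definition P1 :: "real \<Rightarrow> real \<Rightarrow> real" where
  "P1 Q N = (Q - 2 * N - sqrt (Q\<^sup>2 - 4 * Q * N)) / 2"

definition P2 :: "real \<Rightarrow> real \<Rightarrow> real" where
  "P2 Q N = (Q - 2 * N + sqrt (Q\<^sup>2 - 4 * Q * N)) / 2"

definition S_l :: "real \<Rightarrow> real \<Rightarrow> real \<Rightarrow> real" where
  "S_l Q N P = (if P \<in> {0..Q}
     then (sqrt Q - sqrt P)\<^sup>2 * N / ((sqrt Q - sqrt P)\<^sup>2 + N) else 0)"

end

theory Submission
  imports Defs
begin

text \<open>
  Under a Gaussian law every variable is an affine functional of a standard Gaussian vector, so that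
  covariances are inner products and the conditional independences of the policy become
  orthogonality relations. Since \<open>X\<^sub>0\<close> is independent of \<open>W\<^sub>1\<close>, we have
  \<open>I(W\<^sub>2;X\<^sub>0|W\<^sub>1) = I(W\<^sub>1,W\<^sub>2;X\<^sub>0)\<close>, and the information constraint says that \<open>(W\<^sub>1,W\<^sub>2)\<close> reduces
  the variance of \<open>Y\<^sub>1\<close> by at least the factor by which it reduces that of \<open>X\<^sub>0\<close>.

  Write \<open>U\<^sub>1 = \<alpha> X\<^sub>0 + \<beta> W\<^sub>1 + V\<close> with \<open>V\<close> orthogonal to \<open>X\<^sub>0\<close> and \<open>W\<^sub>1\<close>, and put \<open>B = P - \<alpha>\<^sup>2 Q \<ge> 0\<close>.
  The constraint forces the residual variance of \<open>X\<^sub>0\<close> given \<open>(W\<^sub>1,W\<^sub>2)\<close> to be at least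
  \<open>Q N / (B + N)\<close>, hence that of \<open>X\<^sub>1\<close> to be at least \<open>s = (1 + \<alpha>)\<^sup>2 Q N / (B + N)\<close>, and the cost to be
  at least \<open>s N / (s + N)\<close>. Conversely each such pair \<open>(\<alpha>, B)\<close> is realised with equality by
  \<open>V = 0\<close> and \<open>W\<^sub>2\<close> a noisy observation of \<open>X\<^sub>0\<close>. It remains to minimise over \<open>\<alpha>\<close>: the unconstrained
  minimiser is \<open>\<alpha> = - (P + N) / Q\<close>, which is feasible (\<open>B \<ge> 0\<close>) iff \<open>(P + N)\<^sup>2 \<le> Q P\<close>, that is, iff
  \<open>P\<^sub>1 \<le> P \<le> P\<^sub>2\<close>; otherwise the minimum for \<open>P \<le> Q\<close> is at the boundary \<open>\<alpha> = - sqrt (P / Q)\<close>, \<open>B = 0\<close>.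
\<close>

subsection \<open>Standard Gaussian vectors\<close>

text \<open>The density depends on \<open>z\<close> through its norm only, which is the source both
  of the invariance under isometries and of the factorisation over product spaces.\<close>

lemma prod_std_normal_density_eq:
  fixes z :: "'a::euclidean_space"
  shows "(\<Prod>b\<in>Basis. std_normal_density (z \<bullet> b)) = (1 / sqrt (2 * pi)) ^ DIM('a) * exp (- (norm z)\<^sup>2 / 2)"
proof -
  have "(\<Prod>b\<in>Basis. std_normal_density (z \<bullet> b))
      = (\<Prod>b\<in>(Basis::'a set). 1 / sqrt (2 * pi)) * (\<Prod>b\<in>Basis. exp (- (z \<bullet> b)\<^sup>2 / 2))"
    unfolding std_normal_density_def by (rule prod.distrib)
  also have "(\<Prod>b\<in>Basis. exp (- (z \<bullet> b)\<^sup>2 / 2)) = exp (\<Sum>b\<in>Basis. - (z \<bullet> b)\<^sup>2 / 2)"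
    by (simp add: exp_sum)
  also have "(\<Sum>b\<in>Basis. - (z \<bullet> b)\<^sup>2 / 2) = - (norm z)\<^sup>2 / 2"
    unfolding power2_norm_eq_inner euclidean_inner[of z z]
    by (simp add: power2_eq_square sum_negf sum_divide_distrib)
  finally show ?thesis by simp
qed

lemma sets_std_gaussian [simp, measurable_cong]: "sets std_gaussian = sets borel"
  by (simp add: std_gaussian_def)

lemma space_std_gaussian [simp]: "space std_gaussian = UNIV"
  by (simp add: std_gaussian_def)

lemma nn_integral_std_gaussian:
  fixes f :: "'a::euclidean_space \<Rightarrow> ennreal"
  assumes [measurable]: "f \<in> borel_measurable borel"
  shows "(\<integral>\<^sup>+z. f z \<partial>std_gaussian) =
    (\<integral>\<^sup>+z. ennreal (\<Prod>b\<in>Basis. std_normal_density (z \<bullet> b)) * f z \<partial>lborel)"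
  unfolding std_gaussian_def by (subst nn_integral_density) auto

lemma nn_integral_lborel_gaussian:
  "(\<integral>\<^sup>+z. ennreal (\<Prod>b\<in>Basis. std_normal_density ((z::'a::euclidean_space) \<bullet> b)) \<partial>lborel) = 1"
proof -
  have 1: "(\<integral>\<^sup>+x. ennreal (std_normal_density x) \<partial>lborel) = 1"
    by (subst nn_integral_eq_integral) auto
  have "(\<integral>\<^sup>+z. ennreal (\<Prod>b\<in>Basis. std_normal_density ((z::'a) \<bullet> b)) \<partial>lborel)
      = (\<integral>\<^sup>+z. (\<Prod>b\<in>Basis. ennreal (std_normal_density ((z::'a) \<bullet> b))) \<partial>lborel)"
    by (simp add: prod_ennreal)
  also have "\<dots> = 1"
    by (subst nn_integral_lborel_prod) (auto simp: 1)
  finally show ?thesis .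
qed

lemma prob_space_std_gaussian: "prob_space (std_gaussian :: 'a::euclidean_space measure)"
proof
  show "emeasure (std_gaussian :: 'a measure) (space std_gaussian) = 1"
    unfolding std_gaussian_def by (simp add: emeasure_density nn_integral_lborel_gaussian)
qed

interpretation std_gaussian: prob_space "std_gaussian :: 'a::euclidean_space measure"
  by (rule prob_space_std_gaussian)

lemma emeasure_std_gaussian_UNIV [simp]: "emeasure (std_gaussian :: 'a::euclidean_space measure) UNIV = 1"
  using std_gaussian.emeasure_space_1 by simp

section \<open>Invariance under translations and isometries\<close>

lemma nn_integral_lborel_translate:
  fixes h :: "'a::euclidean_space \<Rightarrow> ennreal"
  assumes [measurable]: "h \<in> borel_measurable borel"
  shows "(\<integral>\<^sup>+y. h (c + y) \<partial>lborel) = (\<integral>\<^sup>+y. h y \<partial>lborel)"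
  by (subst (2) lborel_distr_plus[of c, symmetric], subst nn_integral_distr) auto

text \<open>The usual uniqueness argument for Haar measure, with the Gaussian density as the test function:
  it is itself invariant under isometries.\<close>

lemma nn_integral_lborel_isometry:
  fixes f :: "'a::euclidean_space \<Rightarrow> 'a" and h :: "'a \<Rightarrow> ennreal"
  assumes f: "orthogonal_transformation f" and [measurable]: "h \<in> borel_measurable borel"
  shows "(\<integral>\<^sup>+y. h (f y) \<partial>lborel) = (\<integral>\<^sup>+y. h y \<partial>lborel)"
proof -
  define g where "g z = ennreal (\<Prod>b\<in>Basis. std_normal_density ((z::'a) \<bullet> b))" for z
  have g[measurable]: "g \<in> borel_measurable borel" unfolding g_def by measurable
  have lin: "linear f" using f by (simp add: orthogonal_transformation_def)
  have bl: "bounded_linear f" using lin by (simp add: linear_conv_bounded_linear)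
  have fm[measurable]: "f \<in> borel_measurable borel"
    using linear_continuous_on[OF bl] by (rule borel_measurable_continuous_onI)
  have g_f: "g (f z) = g z" for z
    using orthogonal_transformation_norm[OF f, of z] by (simp add: g_def prod_std_normal_density_eq)
  have g_minus: "g (- z) = g z" for z
    unfolding g_def prod_std_normal_density_eq by simp
  have int_g: "(\<integral>\<^sup>+x. g x \<partial>lborel) = 1" unfolding g_def by (rule nn_integral_lborel_gaussian)
  have surj: "\<exists>x'. f x' = x" for x
    using orthogonal_transformation_surj[OF f] by (metis surj_def)
  have "(\<integral>\<^sup>+y. h (f y) \<partial>lborel) = (\<integral>\<^sup>+x. g x * (\<integral>\<^sup>+y. h (f y) \<partial>lborel) \<partial>lborel)"
    by (subst nn_integral_multc) (auto simp: int_g)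
  \<comment> \<open>As \<open>f\<close> is onto, \<open>x\<close> is some \<open>f x'\<close>;
    translating \<open>y\<close> by \<open>x'\<close> then turns \<open>h (f y)\<close> into
    \<open>h (x + f y)\<close>.\<close>
  also have "\<dots> = (\<integral>\<^sup>+x. (\<integral>\<^sup>+y. g x * h (x + f y) \<partial>lborel) \<partial>lborel)"
  proof (rule nn_integral_cong)
    fix x
    obtain x' where x': "f x' = x" using surj by blast
    have "(\<integral>\<^sup>+y. h (f y) \<partial>lborel) = (\<integral>\<^sup>+y. h (f (x' + y)) \<partial>lborel)"
      by (subst nn_integral_lborel_translate[of "\<lambda>y. h (f y)"]) auto
    then show "g x * (\<integral>\<^sup>+y. h (f y) \<partial>lborel) = (\<integral>\<^sup>+y. g x * h (x + f y) \<partial>lborel)"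
      by (subst nn_integral_cmult) (auto simp: linear_add[OF lin] x')
  qed
  also have "\<dots> = (\<integral>\<^sup>+y. (\<integral>\<^sup>+x. g x * h (x + f y) \<partial>lborel) \<partial>lborel)"
    by (subst lborel_pair.Fubini') auto
  also have "\<dots> = (\<integral>\<^sup>+y. (\<integral>\<^sup>+x. g (x - f y) * h x \<partial>lborel) \<partial>lborel)"
  proof (rule nn_integral_cong)
    fix y
    show "(\<integral>\<^sup>+x. g x * h (x + f y) \<partial>lborel) = (\<integral>\<^sup>+x. g (x - f y) * h x \<partial>lborel)"
      using nn_integral_lborel_translate[of "\<lambda>x. g (x - f y) * h x" "f y"]
      by (simp add: add.commute)
  qed
  also have "\<dots> = (\<integral>\<^sup>+x. (\<integral>\<^sup>+y. g (x - f y) * h x \<partial>lborel) \<partial>lborel)"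
    by (rule lborel_pair.Fubini') measurable
  also have "\<dots> = (\<integral>\<^sup>+x. h x \<partial>lborel)"
  proof (rule nn_integral_cong)
    fix x
    obtain x' where x': "f x' = x" using surj by blast
    \<comment> \<open>Norm preservation and evenness of \<open>g\<close> remove \<open>f\<close>,
      and the remaining integral over \<open>y\<close> is a translate of the normalised one.\<close>
    have "g (x - f y) = g (- x' + y)" for y
      using g_f[of "x' - y"] g_minus[of "x' - y"] by (simp add: linear_diff[OF lin] x')
    then have "(\<integral>\<^sup>+y. g (x - f y) \<partial>lborel) = 1"
      using nn_integral_lborel_translate[of g "- x'"] by (simp add: int_g)
    then show "(\<integral>\<^sup>+y. g (x - f y) * h x \<partial>lborel) = h x"
      by (subst nn_integral_multc) auto
  qed
  finally show ?thesis .
qed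

text \<open>Isometries preserve Lebesgue measure and the norm, hence also the Gaussian
  density.\<close>

lemma nn_integral_std_gaussian_isometry:
  fixes f :: "'a::euclidean_space \<Rightarrow> 'a" and h :: "'a \<Rightarrow> ennreal"
  assumes f: "orthogonal_transformation f" and [measurable]: "h \<in> borel_measurable borel"
  shows "(\<integral>\<^sup>+z. h (f z) \<partial>std_gaussian) = (\<integral>\<^sup>+z. h z \<partial>std_gaussian)"
proof -
  have "linear f" using f by (simp add: orthogonal_transformation_def)
  then have [measurable]: "f \<in> borel_measurable borel"
    by (intro borel_measurable_continuous_onI linear_continuous_on)
      (simp add: linear_conv_bounded_linear)
  have "(\<integral>\<^sup>+z. h (f z) \<partial>std_gaussian) =
      (\<integral>\<^sup>+z. ennreal (\<Prod>b\<in>Basis. std_normal_density (f z \<bullet> b)) * h (f z) \<partial>lborel)"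
    using orthogonal_transformation_norm[OF f]
    by (simp add: nn_integral_std_gaussian prod_std_normal_density_eq)
  also have "\<dots> = (\<integral>\<^sup>+z. h z \<partial>std_gaussian)"
    by (subst nn_integral_lborel_isometry[OF f]) (auto simp: nn_integral_std_gaussian)
  finally show ?thesis .
qed

section \<open>Product structure and independence of orthogonal components\<close>

lemma nn_integral_std_gaussian_prod:
  fixes h :: "'a::euclidean_space \<times> 'b::euclidean_space \<Rightarrow> ennreal"
  assumes [measurable]: "h \<in> borel_measurable borel"
  shows "(\<integral>\<^sup>+p. h p \<partial>std_gaussian) = (\<integral>\<^sup>+z. \<integral>\<^sup>+t. h (z, t) \<partial>std_gaussian \<partial>std_gaussian)"
proof -
  have [measurable]: "h \<in> borel_measurable (borel \<Otimes>\<^sub>M borel)" by (simp add: borel_prod)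
  have split: "(\<Prod>b\<in>Basis. std_normal_density ((z, t) \<bullet> b)) =
      (\<Prod>b\<in>Basis. std_normal_density (z \<bullet> b)) * (\<Prod>b\<in>Basis. std_normal_density (t \<bullet> b))"
    for z :: 'a and t :: 'b
    by (simp add: prod_std_normal_density_eq norm_Pair power_add exp_add[symmetric] add_divide_distrib)
  have "(\<integral>\<^sup>+p. h p \<partial>std_gaussian) =
      (\<integral>\<^sup>+p. ennreal (\<Prod>b\<in>Basis. std_normal_density (p \<bullet> b)) * h p \<partial>(lborel \<Otimes>\<^sub>M lborel))"
    by (simp add: nn_integral_std_gaussian lborel_prod)
  also have "\<dots> = (\<integral>\<^sup>+z. \<integral>\<^sup>+t. ennreal (\<Prod>b\<in>Basis. std_normal_density ((z, t) \<bullet> b)) * h (z, t)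
      \<partial>lborel \<partial>lborel)"
    by (subst lborel.nn_integral_fst[symmetric])
      (auto intro!: measurable_compose[OF _ measurable_ennreal] simp: lborel_prod)
  also have "\<dots> = (\<integral>\<^sup>+z. ennreal (\<Prod>b\<in>Basis. std_normal_density (z \<bullet> b)) *
      (\<integral>\<^sup>+t. ennreal (\<Prod>b\<in>Basis. std_normal_density (t \<bullet> b)) * h (z, t) \<partial>lborel) \<partial>lborel)"
    unfolding split
    by (subst nn_integral_cmult[symmetric])
      (auto simp: ennreal_mult prod_nonneg mult.assoc intro!: nn_integral_cong)
  also have "\<dots> = (\<integral>\<^sup>+z. \<integral>\<^sup>+t. h (z, t) \<partial>std_gaussian \<partial>std_gaussian)"
  proof -
    have [measurable]: "(\<lambda>z. \<integral>\<^sup>+t. h (z, t) \<partial>std_gaussian) \<in> borel_measurable borel"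
      by measurable
    show ?thesis
      by (subst (2) nn_integral_std_gaussian) (auto simp: nn_integral_std_gaussian)
  qed
  finally show ?thesis .
qed

lemma std_gaussian_real: "(std_gaussian :: real measure) = density lborel std_normal_density"
  by (simp add: std_gaussian_def)

text \<open>Exchanging the component of \<open>z\<close> along \<open>r\<close> with an independent standard normal \<open>t\<close> is an
  isometry of the product space; this yields the independence of orthogonal components.\<close>

lemma orthogonal_transformation_exchange:
  fixes r :: "'a::euclidean_space"
  assumes "norm r = 1"
  shows "orthogonal_transformation (\<lambda>(z, t). (z - (z \<bullet> r) *\<^sub>R r + t *\<^sub>R r, z \<bullet> r))"
proof -
  have "r \<bullet> r = 1" using assms by (simp add: norm_eq_1)
  then show ?thesis
    unfolding orthogonal_transformation_def
    by (auto simp: algebra_simps inner_commute intro!: linearI)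
qed

text \<open>Under the exchange isometry \<open>g\<close> does not notice the change along
  \<open>r\<close>, while the slot \<open>t\<close> becomes \<open>z \<bullet> r\<close>. In
  probabilistic terms, \<open>r \<bullet> z\<close> is standard normal and independent of
  \<open>g z\<close>.\<close>

lemma nn_integral_std_gaussian_orthogonal:
  fixes r :: "'a::euclidean_space" and h :: "'b \<times> real \<Rightarrow> ennreal" and g :: "'a \<Rightarrow> 'b"
  assumes r: "norm r = 1" and [measurable]: "g \<in> std_gaussian \<rightarrow>\<^sub>M S" "h \<in> borel_measurable (S \<Otimes>\<^sub>M borel)"
    and g: "\<And>z t. g (z + t *\<^sub>R r) = g z"
  shows "(\<integral>\<^sup>+z. h (g z, r \<bullet> z) \<partial>std_gaussian) = (\<integral>\<^sup>+z. \<integral>\<^sup>+t. h (g z, t) \<partial>std_gaussian \<partial>std_gaussian)"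
proof -
  define H where "H = (\<lambda>p. h (g (fst p), snd p))"
  have [measurable]: "g \<in> borel \<rightarrow>\<^sub>M S" by (simp add: measurable_cong_sets[OF sets_std_gaussian[symmetric] refl])
  have "H \<in> borel_measurable (borel \<Otimes>\<^sub>M borel)"
    unfolding H_def
    by (intro measurable_compose[OF _ assms(3)] measurable_Pair
        measurable_compose[OF measurable_fst \<open>g \<in> borel \<rightarrow>\<^sub>M S\<close>] measurable_snd)
  then have H[measurable]: "H \<in> borel_measurable borel" by (simp add: borel_prod)
  have Hm: "(\<lambda>p. H (fst p - (fst p \<bullet> r) *\<^sub>R r + snd p *\<^sub>R r, fst p \<bullet> r)) \<in> borel_measurable borel"
    by (intro measurable_compose[OF _ H] borel_measurable_continuous_onI continuous_intros)
  have gg: "g (z - (z \<bullet> r) *\<^sub>R r + t *\<^sub>R r) = g z" for z t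
    using g[of z "t - z \<bullet> r"] by (simp add: algebra_simps)
  have "(\<integral>\<^sup>+z. \<integral>\<^sup>+t. h (g z, t) \<partial>std_gaussian \<partial>std_gaussian) = (\<integral>\<^sup>+p. H p \<partial>std_gaussian)"
    by (subst nn_integral_std_gaussian_prod[OF H]) (simp add: H_def)
  also have "\<dots> = (\<integral>\<^sup>+p. H (fst p - (fst p \<bullet> r) *\<^sub>R r + snd p *\<^sub>R r, fst p \<bullet> r) \<partial>std_gaussian)"
    using nn_integral_std_gaussian_isometry[OF orthogonal_transformation_exchange[OF r] H]
    by (simp add: case_prod_beta)
  also have "\<dots> = (\<integral>\<^sup>+z. \<integral>\<^sup>+t. H (z - (z \<bullet> r) *\<^sub>R r + t *\<^sub>R r, z \<bullet> r)
      \<partial>(std_gaussian :: real measure) \<partial>std_gaussian)"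
    by (subst nn_integral_std_gaussian_prod[OF Hm]) simp
  also have "\<dots> = (\<integral>\<^sup>+z. h (g z, r \<bullet> z) \<partial>std_gaussian)"
    by (simp add: H_def gg inner_commute)
  finally show ?thesis by simp
qed

text \<open>A reflection argument: \<open>q \<bullet> z\<close> changes sign while \<open>g z\<close> does not.\<close>

lemma nn_integral_std_gaussian_symmetric:
  fixes q :: "'a::euclidean_space" and h :: "'b \<times> real \<Rightarrow> ennreal" and g :: "'a \<Rightarrow> 'b"
  assumes [measurable]: "g \<in> std_gaussian \<rightarrow>\<^sub>M S" "h \<in> borel_measurable (S \<Otimes>\<^sub>M borel)"
    and g: "\<And>z t. g (z + t *\<^sub>R q) = g z"
  shows "(\<integral>\<^sup>+z. h (g z, q \<bullet> z) \<partial>std_gaussian) = (\<integral>\<^sup>+z. h (g z, - (q \<bullet> z)) \<partial>std_gaussian)"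
proof -
  have [measurable]: "g \<in> borel \<rightarrow>\<^sub>M S" by (simp add: measurable_cong_sets[OF sets_std_gaussian[symmetric] refl])
  \<comment> \<open>The reflection in the hyperplane orthogonal to \<open>q\<close>. For
    \<open>q = 0\<close> it is the identity, so no case is lost.\<close>
  define f where "f z = z - (2 * (q \<bullet> z) / (q \<bullet> q)) *\<^sub>R q" for z
  have "linear f"
    unfolding f_def by (auto intro!: linearI simp: algebra_simps inner_add_right add_divide_distrib)
  moreover have "f v \<bullet> f w = v \<bullet> w" for v w
    by (cases "q = 0")
      (simp_all add: f_def inner_diff_left inner_diff_right inner_commute field_simps)
  ultimately have f: "orthogonal_transformation f"
    by (simp add: orthogonal_transformation_def)
  have gf: "g (f z) = g z" for z
    using g[of z "- (2 * (q \<bullet> z) / (q \<bullet> q))"] by (simp add: f_def)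
  have qf: "q \<bullet> f z = - (q \<bullet> z)" for z
    by (cases "q = 0") (simp_all add: f_def inner_diff_right)
  have "(\<integral>\<^sup>+z. h (g z, q \<bullet> z) \<partial>std_gaussian) = (\<integral>\<^sup>+z. h (g (f z), q \<bullet> f z) \<partial>std_gaussian)"
    by (subst nn_integral_std_gaussian_isometry[OF f, of "\<lambda>z. h (g z, q \<bullet> z)"]) auto
  then show ?thesis by (simp add: gf qf)
qed

section \<open>One-dimensional marginals and moments\<close>

text \<open>The independence lemma is applied with a constant \<open>g\<close> and the unit vector
  along \<open>a\<close>; for \<open>a = 0\<close> both sides integrate the constant
  \<open>h 0\<close>.\<close>

lemma nn_integral_std_gaussian_inner:
  fixes a :: "'a::euclidean_space"
  assumes [measurable]: "h \<in> borel_measurable borel"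
  shows "(\<integral>\<^sup>+z. h (a \<bullet> z) \<partial>std_gaussian) = (\<integral>\<^sup>+t. h (norm a * t) \<partial>std_gaussian)"
proof (cases "a = 0")
  case False
  define r where "r = (1 / norm a) *\<^sub>R a"
  have r: "norm r = 1" "a = norm a *\<^sub>R r" using False by (auto simp: r_def)
  have "(\<integral>\<^sup>+z. h (a \<bullet> z) \<partial>std_gaussian) = (\<integral>\<^sup>+z. h (norm a * (r \<bullet> z)) \<partial>std_gaussian)"
    by (subst r(2)) simp
  also have "\<dots> = (\<integral>\<^sup>+z. \<integral>\<^sup>+t. h (norm a * t) \<partial>std_gaussian \<partial>(std_gaussian :: 'a measure))"
    using nn_integral_std_gaussian_orthogonal[of r "\<lambda>_. ()" "count_space UNIV" "\<lambda>p. h (norm a * snd p)"] r(1)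
    by simp
  finally show ?thesis by simp
qed simp

lemma distr_std_gaussian_inner:
  fixes a :: "'a::euclidean_space"
  shows "distr std_gaussian borel (\<lambda>z. a \<bullet> z) = distr std_gaussian borel (\<lambda>t::real. norm a * t)"
proof (rule measure_eqI)
  fix A assume "A \<in> sets (distr std_gaussian borel (\<lambda>z. a \<bullet> z))"
  then have A[measurable]: "A \<in> sets borel" by simp
  have "emeasure (distr std_gaussian borel (\<lambda>z. a \<bullet> z)) A = (\<integral>\<^sup>+z. indicator A (a \<bullet> z) \<partial>std_gaussian)"
    by (subst nn_integral_indicator[symmetric], simp, subst nn_integral_distr) auto
  also have "\<dots> = emeasure (distr std_gaussian borel (\<lambda>t::real. norm a * t)) A"
    by (subst nn_integral_std_gaussian_inner, simp)
      (subst nn_integral_indicator[symmetric], simp, subst nn_integral_distr, auto)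
  finally show "emeasure (distr std_gaussian borel (\<lambda>z. a \<bullet> z)) A =
    emeasure (distr std_gaussian borel (\<lambda>t::real. norm a * t)) A" .
qed simp

lemma std_gaussian_real_moment:
  "has_bochner_integral (std_gaussian :: real measure) (\<lambda>t. t) 0"
  "has_bochner_integral (std_gaussian :: real measure) (\<lambda>t. t\<^sup>2) 1"
  using std_normal_moment_odd[of 0] std_normal_moment_even[of 1]
  by (auto simp: std_gaussian_real intro!: has_bochner_integral_density)

lemma std_gaussian_inner_moment:
  fixes a :: "'a::euclidean_space"
  shows "has_bochner_integral std_gaussian (\<lambda>z. a \<bullet> z) 0"
    and "has_bochner_integral std_gaussian (\<lambda>z. (a \<bullet> z)\<^sup>2) (a \<bullet> a)"
proof -
  have *: "has_bochner_integral std_gaussian (\<lambda>z. f (a \<bullet> z)) x"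
    if "has_bochner_integral std_gaussian (\<lambda>t. f (norm a * t)) x" "f \<in> borel_measurable borel"
    for f :: "real \<Rightarrow> real" and x
  proof -
    have "has_bochner_integral (distr std_gaussian borel (\<lambda>z. a \<bullet> z)) f x"
      unfolding distr_std_gaussian_inner by (rule has_bochner_integral_distr) (use that in auto)
    then show ?thesis
      using that(2) by (auto simp: has_bochner_integral_iff integrable_distr_eq integral_distr)
  qed
  show "has_bochner_integral std_gaussian (\<lambda>z. a \<bullet> z) 0"
    using has_bochner_integral_mult_right[OF std_gaussian_real_moment(1), of "norm a"]
    by (intro *) auto
  show "has_bochner_integral std_gaussian (\<lambda>z. (a \<bullet> z)\<^sup>2) (a \<bullet> a)"
    using has_bochner_integral_mult_right[OF std_gaussian_real_moment(2), of "(norm a)\<^sup>2"]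
    by (intro *[of "\<lambda>t. t\<^sup>2"]) (auto simp: power_mult_distrib power2_norm_eq_inner)
qed

text \<open>Polarisation reduces the mixed moment to the second moments of \<open>a + b\<close> and
  \<open>a - b\<close>. This is the bridge between covariances and inner products.\<close>

lemma std_gaussian_affine_moment:
  fixes a b :: "'a::euclidean_space"
  shows "has_bochner_integral std_gaussian (\<lambda>z. (m + a \<bullet> z) * (k + b \<bullet> z)) (m * k + a \<bullet> b)"
proof -
  have eq: "(m + a \<bullet> z) * (k + b \<bullet> z) =
      m * k + (m * (b \<bullet> z) + k * (a \<bullet> z)) + (1 / 4) * (((a + b) \<bullet> z)\<^sup>2 - ((a - b) \<bullet> z)\<^sup>2)" for z
    by (simp add: inner_add_left inner_diff_left power2_eq_square algebra_simps)
  have c: "has_bochner_integral (std_gaussian :: 'a measure) (\<lambda>z. m * k) (m * k)"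
    using has_bochner_integral_integrable[of "std_gaussian :: 'a measure" "\<lambda>z. m * k"]
      std_gaussian.prob_space[where 'a='a] by simp
  have "has_bochner_integral std_gaussian (\<lambda>z. (m + a \<bullet> z) * (k + b \<bullet> z))
      (m * k + (m * 0 + k * 0) + (1 / 4) * ((a + b) \<bullet> (a + b) - (a - b) \<bullet> (a - b)))"
    unfolding eq
    by (intro has_bochner_integral_add has_bochner_integral_diff has_bochner_integral_mult_right
        std_gaussian_inner_moment c)
  then show ?thesis
    by (simp add: inner_add_left inner_diff_left inner_add_right inner_diff_right inner_commute)
qed

lemma nn_integral_std_gaussian_real_affine:
  fixes h :: "real \<Rightarrow> ennreal"
  assumes "\<sigma> > 0" and [measurable]: "h \<in> borel_measurable borel"
  shows "(\<integral>\<^sup>+t. h (a + \<sigma> * t) \<partial>std_gaussian) = (\<integral>\<^sup>+y. ennreal (normal_density a \<sigma> y) * h y \<partial>lborel)"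
proof -
  have nd: "\<sigma> * normal_density a \<sigma> (a + \<sigma> * t) = std_normal_density t" for t
    using assms(1) by (simp add: normal_density_def real_sqrt_mult power_mult_distrib)
  have "(\<integral>\<^sup>+y. ennreal (normal_density a \<sigma> y) * h y \<partial>lborel) =
      (\<integral>\<^sup>+t. ennreal \<sigma> * (ennreal (normal_density a \<sigma> (a + \<sigma> * t)) * h (a + \<sigma> * t)) \<partial>lborel)"
    using assms(1) by (subst nn_integral_real_affine[of _ \<sigma> a]) (auto simp: nn_integral_cmult)
  also have "\<dots> = (\<integral>\<^sup>+t. ennreal (std_normal_density t) * h (a + \<sigma> * t) \<partial>lborel)"
    using assms(1) by (simp add: mult.assoc[symmetric] ennreal_mult[symmetric] nd)
  also have "\<dots> = (\<integral>\<^sup>+t. h (a + \<sigma> * t) \<partial>std_gaussian)"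
    by (simp add: std_gaussian_real nn_integral_density)
  finally show ?thesis by simp
qed

lemma distr_std_gaussian_affine:
  fixes a :: "'a::euclidean_space"
  assumes "a \<noteq> 0"
  shows "distr std_gaussian borel (\<lambda>z. m + a \<bullet> z) = density lborel (normal_density m (norm a))"
proof (rule measure_eqI)
  fix A assume "A \<in> sets (distr std_gaussian borel (\<lambda>z. m + a \<bullet> z))"
  then have A[measurable]: "A \<in> sets borel" by simp
  have "emeasure (distr std_gaussian borel (\<lambda>z. m + a \<bullet> z)) A =
      (\<integral>\<^sup>+z. indicator A (m + a \<bullet> z) \<partial>std_gaussian)"
    by (subst nn_integral_indicator[symmetric], simp, subst nn_integral_distr) auto
  also have "\<dots> = (\<integral>\<^sup>+t. indicator A (m + norm a * t) \<partial>std_gaussian)"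
    by (subst nn_integral_std_gaussian_inner[of "\<lambda>x. indicator A (m + x)"]) auto
  also have "\<dots> = emeasure (density lborel (normal_density m (norm a))) A"
    using assms by (subst nn_integral_std_gaussian_real_affine) (auto simp: emeasure_density)
  finally show "emeasure (distr std_gaussian borel (\<lambda>z. m + a \<bullet> z)) A =
    emeasure (density lborel (normal_density m (norm a))) A" .
qed simp

subsection \<open>Mutual information\<close>

text \<open>Almost everywhere uniqueness of the Radon-Nikodym derivative lets \<open>f\<close>
  replace it under the logarithm, and integrability selects the finite branch of the
  definition.\<close>

lemma KL_divergence_ext_density:
  assumes "sigma_finite_measure M" and f[measurable]: "f \<in> borel_measurable M"
    and pos: "\<And>x. x \<in> space M \<Longrightarrow> f x > 0"
    and int: "integrable (density M (\<lambda>x. ennreal (f x))) (\<lambda>x. log b (f x))"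
  shows "KL_divergence_ext b M (density M (\<lambda>x. ennreal (f x))) =
    ereal (\<integral>x. log b (f x) \<partial>density M (\<lambda>x. ennreal (f x)))"
proof -
  interpret sigma_finite_measure M by fact
  let ?N = "density M (\<lambda>x. ennreal (f x))"
  have "AE x in M. ennreal (f x) = RN_deriv M ?N x"
    by (rule RN_deriv_unique) auto
  then have AE: "AE x in ?N. log b (f x) = entropy_density b M ?N x"
    by (subst AE_density, simp, elim AE_mp)
      (intro AE_I2 impI, metis comp_apply enn2real_ennreal entropy_density_def less_imp_le pos)
  have m: "entropy_density b M ?N \<in> borel_measurable ?N" by simp
  have "integrable ?N (entropy_density b M ?N)"
    using int by (rule integrable_cong_AE_imp[OF _ m]) (use AE in auto)
  moreover have "(\<integral>x. log b (f x) \<partial>?N) = KL_divergence b M ?N"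
    unfolding KL_divergence_def
    by (intro integral_cong_AE borel_measurable_integrable[OF int] m AE)
  moreover have "absolutely_continuous M ?N"
    by (rule absolutely_continuousI_density) simp
  ultimately show ?thesis by (simp add: KL_divergence_ext_def)
qed

context
  fixes w1 w2 y r :: "'a::euclidean_space" and c1 c2 \<mu>1 \<mu>2 m :: real
  assumes y: "y = c1 *\<^sub>R w1 + c2 *\<^sub>R w2 + r"
    and orth: "r \<bullet> w1 = 0" "r \<bullet> w2 = 0"
    and nz: "y \<noteq> 0"
begin

text \<open>Without a residual, the second variable is an affine function of the pair, so the joint
  law lives on a graph. Since \<open>y \<noteq> 0\<close>, the second marginal has a density, every
  section of the graph is null, and absolute continuity fails.\<close>

lemma mutual_info_gaussian_infinite:
  assumes "r = 0"
  shows "mutual_info b std_gaussian (borel \<Otimes>\<^sub>M borel) borel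
    (\<lambda>z. (\<mu>1 + w1 \<bullet> z, \<mu>2 + w2 \<bullet> z)) (\<lambda>z. m + y \<bullet> z) = \<infinity>"
proof -
  let ?W = "\<lambda>z. (\<mu>1 + w1 \<bullet> z, \<mu>2 + w2 \<bullet> z)" and ?Y = "\<lambda>z. m + y \<bullet> z"
  let ?reg = "\<lambda>w::real \<times> real. m + c1 * (fst w - \<mu>1) + c2 * (snd w - \<mu>2)"
  have [measurable]: "?W \<in> std_gaussian \<rightarrow>\<^sub>M borel \<Otimes>\<^sub>M borel" by measurable
  let ?MW = "distr std_gaussian (borel \<Otimes>\<^sub>M borel) ?W" and ?MY = "distr std_gaussian borel ?Y"
  let ?J = "distr std_gaussian ((borel \<Otimes>\<^sub>M borel) \<Otimes>\<^sub>M borel) (\<lambda>z. (?W z, ?Y z))"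
  interpret MW: prob_space ?MW by (rule std_gaussian.prob_space_distr) simp
  interpret MY: prob_space ?MY by (rule std_gaussian.prob_space_distr) simp
  define A where "A = {p \<in> space ((borel \<Otimes>\<^sub>M borel) \<Otimes>\<^sub>M borel). snd p = ?reg (fst p)}"
  have A[measurable]: "A \<in> sets ((borel \<Otimes>\<^sub>M borel) \<Otimes>\<^sub>M borel)"
    unfolding A_def by measurable
  have "emeasure (?MW \<Otimes>\<^sub>M ?MY) A = (\<integral>\<^sup>+w. emeasure ?MY (Pair w -` A) \<partial>?MW)"
    by (rule MY.emeasure_pair_measure_alt) simp
  also have "\<dots> = 0"
  proof -
    have "emeasure ?MY (Pair w -` A) = 0" for w
    proof -
      have "Pair w -` A = {?reg w}" by (auto simp: A_def space_pair_measure)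
      then show ?thesis
        by (subst distr_std_gaussian_affine[OF nz])
          (auto simp: emeasure_density nn_integral_indicator_singleton)
    qed
    then show ?thesis by simp
  qed
  finally have null: "A \<in> null_sets (?MW \<Otimes>\<^sub>M ?MY)" by auto
  have J_A: "emeasure ?J A = 1"
  proof -
    have "(\<lambda>z. (?W z, ?Y z)) -` A \<inter> space std_gaussian = UNIV"
      using assms by (auto simp: A_def space_pair_measure y inner_add_left)
    then show ?thesis by (subst emeasure_distr) auto
  qed
  have "\<not> absolutely_continuous (?MW \<Otimes>\<^sub>M ?MY) ?J"
  proof
    assume "absolutely_continuous (?MW \<Otimes>\<^sub>M ?MY) ?J"
    then have "A \<in> null_sets ?J" using null unfolding absolutely_continuous_def by (rule subsetD)
    then have "emeasure ?J A = 0" by (rule null_setsD1)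
    with J_A show False by simp
  qed
  then show ?thesis by (simp add: mutual_info_def KL_divergence_ext_def)
qed

text \<open>Given the pair, the second variable is normal around its regression with standard
  deviation \<open>norm r\<close>. The density of the joint law against the product of the marginals
  is therefore a quotient of two normal densities, and the quadratic terms of its logarithm cancel
  in the mean.\<close>

lemma mutual_info_gaussian_finite:
  assumes r: "r \<noteq> 0" and b: "b > 1"
  shows "mutual_info b std_gaussian (borel \<Otimes>\<^sub>M borel) borel
    (\<lambda>z. (\<mu>1 + w1 \<bullet> z, \<mu>2 + w2 \<bullet> z)) (\<lambda>z. m + y \<bullet> z) = ereal (log b (norm y / norm r))"
proof -
  let ?W = "\<lambda>z. (\<mu>1 + w1 \<bullet> z, \<mu>2 + w2 \<bullet> z)" and ?Y = "\<lambda>z. m + y \<bullet> z"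
  let ?reg = "\<lambda>w::real \<times> real. m + c1 * (fst w - \<mu>1) + c2 * (snd w - \<mu>2)"
  have Y_eq: "?Y z = ?reg (?W z) + r \<bullet> z" for z
    by (simp add: y inner_add_left)
  have [measurable]: "?W \<in> std_gaussian \<rightarrow>\<^sub>M borel \<Otimes>\<^sub>M borel" by measurable
  let ?MW = "distr std_gaussian (borel \<Otimes>\<^sub>M borel) ?W" and ?MY = "distr std_gaussian borel ?Y"
  let ?J = "distr std_gaussian ((borel \<Otimes>\<^sub>M borel) \<Otimes>\<^sub>M borel) (\<lambda>z. (?W z, ?Y z))"
  interpret MW: prob_space ?MW by (rule std_gaussian.prob_space_distr) simp
  interpret MY: prob_space ?MY by (rule std_gaussian.prob_space_distr) simp
  interpret P: pair_prob_space ?MW ?MY ..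
  define f where "f = (\<lambda>p. normal_density (?reg (fst p)) (norm r) (snd p) / normal_density m (norm y) (snd p))"
  have nd_m: "(\<lambda>p. normal_density (?reg (fst p)) (norm r) (snd p)) \<in> borel_measurable ((borel \<Otimes>\<^sub>M borel) \<Otimes>\<^sub>M borel)"
    unfolding normal_density_def by measurable
  then have f[measurable]: "f \<in> borel_measurable ((borel \<Otimes>\<^sub>M borel) \<Otimes>\<^sub>M borel)"
    unfolding f_def by measurable
  have pos: "f p > 0" for p
    using r nz by (auto simp: f_def intro!: divide_pos_pos normal_density_pos)
  have J: "?J = density (?MW \<Otimes>\<^sub>M ?MY) (\<lambda>p. ennreal (f p))"
  proof (rule measure_eqI)
    show "sets ?J = sets (density (?MW \<Otimes>\<^sub>M ?MY) (\<lambda>p. ennreal (f p)))"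
      by (simp cong: sets_pair_measure_cong)
    fix A assume "A \<in> sets ?J"
    then have A[measurable]: "A \<in> sets ((borel \<Otimes>\<^sub>M borel) \<Otimes>\<^sub>M borel)" by simp
    define u where "u = (1 / norm r) *\<^sub>R r"
    have u: "norm u = 1" "r = norm r *\<^sub>R u" using r by (auto simp: u_def)
    have uW: "?W (z + t *\<^sub>R u) = ?W z" for z t
      using orth by (simp add: u_def inner_add_right inner_commute)
    have "emeasure ?J A = (\<integral>\<^sup>+z. indicator A (?W z, ?Y z) \<partial>std_gaussian)"
      by (subst nn_integral_indicator[symmetric], simp, subst nn_integral_distr) auto
    also have "\<dots> = (\<integral>\<^sup>+z. indicator A (?W z, ?reg (?W z) + norm r * (u \<bullet> z)) \<partial>std_gaussian)"
    proof -
      have "r \<bullet> z = norm r * (u \<bullet> z)" for z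
        using r by (simp add: u_def)
      then show ?thesis unfolding Y_eq by simp
    qed
    also have "\<dots> = (\<integral>\<^sup>+z. \<integral>\<^sup>+t. indicator A (?W z, ?reg (?W z) + norm r * t) \<partial>std_gaussian \<partial>std_gaussian)"
      using nn_integral_std_gaussian_orthogonal[OF u(1), of ?W "borel \<Otimes>\<^sub>M borel"
          "\<lambda>p. indicator A (fst p, ?reg (fst p) + norm r * snd p)", OF _ _ uW]
      by simp
    also have "\<dots> = (\<integral>\<^sup>+z. \<integral>\<^sup>+t. ennreal (normal_density (?reg (?W z)) (norm r) t) * indicator A (?W z, t) \<partial>lborel \<partial>std_gaussian)"
      using r by (intro nn_integral_cong, subst nn_integral_std_gaussian_real_affine) auto
    also have "\<dots> = (\<integral>\<^sup>+z. \<integral>\<^sup>+t. ennreal (normal_density m (norm y) t) *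
        (ennreal (f (?W z, t)) * indicator A (?W z, t)) \<partial>lborel \<partial>std_gaussian)"
      using nz by (auto simp: f_def mult.assoc[symmetric] ennreal_mult[symmetric] normal_density_pos[THEN less_imp_neq, symmetric]
         intro!: nn_integral_cong)
    also have "\<dots> = (\<integral>\<^sup>+z. \<integral>\<^sup>+t. ennreal (f (?W z, t)) * indicator A (?W z, t) \<partial>?MY \<partial>std_gaussian)"
      by (subst distr_std_gaussian_affine[OF nz], subst nn_integral_density) auto
    also have "\<dots> = (\<integral>\<^sup>+w. \<integral>\<^sup>+t. ennreal (f (w, t)) * indicator A (w, t) \<partial>?MY \<partial>?MW)"
      by (subst nn_integral_distr) auto
    also have "\<dots> = (\<integral>\<^sup>+p. ennreal (f p) * indicator A p \<partial>(?MW \<Otimes>\<^sub>M ?MY))"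
      by (subst MY.nn_integral_fst) auto
    also have "\<dots> = emeasure (density (?MW \<Otimes>\<^sub>M ?MY) (\<lambda>p. ennreal (f p))) A"
      by (subst emeasure_density) auto
    finally show "emeasure ?J A = emeasure (density (?MW \<Otimes>\<^sub>M ?MY) (\<lambda>p. ennreal (f p))) A" .
  qed
  \<comment> \<open>The squares are written in the product form of the affine moment formula with
    zero constants; after normalisation each has mean 1.\<close>
  have log_f: "log b (f (?W z, ?Y z)) = log b (norm y / norm r) +
      (1 / (2 * ln b)) * ((0 + y \<bullet> z) * (0 + y \<bullet> z) * (1 / (y \<bullet> y)) - (0 + r \<bullet> z) * (0 + r \<bullet> z) * (1 / (r \<bullet> r)))" for z
  proof -
    have *: "ln (normal_density a s x) = - ln (sqrt (2 * pi)) - ln s - (x - a)\<^sup>2 / (2 * s\<^sup>2)" if "s > 0" for a s x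
      using that by (simp add: normal_density_def ln_mult ln_div real_sqrt_mult)
    have nd0: "normal_density a s x \<noteq> 0" if "s > 0" for a s x
      using normal_density_pos[OF that, of a x] by simp
    have "ln (f (?W z, ?Y z)) = ln (norm y) - ln (norm r) + (y \<bullet> z)\<^sup>2 / (2 * (norm y)\<^sup>2) - (r \<bullet> z)\<^sup>2 / (2 * (norm r)\<^sup>2)"
      using r nz Y_eq[of z] by (simp add: f_def ln_div nd0 *)
    then have *: "ln (f (?W z, ?Y z)) =
        ln (norm y) - ln (norm r) + (y \<bullet> z)\<^sup>2 / (2 * (y \<bullet> y)) - (r \<bullet> z)\<^sup>2 / (2 * (r \<bullet> r))"
      by (simp only: power2_norm_eq_inner)
    show ?thesis
      unfolding log_def * using b r nz by (simp add: ln_div power2_eq_square field_simps)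
  qed
  have "has_bochner_integral std_gaussian (\<lambda>z. log b (f (?W z, ?Y z)))
      (log b (norm y / norm r) + (1 / (2 * ln b)) * ((0 * 0 + y \<bullet> y) * (1 / (y \<bullet> y)) - (0 * 0 + r \<bullet> r) * (1 / (r \<bullet> r))))"
    unfolding log_f
    by (intro has_bochner_integral_add has_bochner_integral_diff has_bochner_integral_mult_right
        has_bochner_integral_mult_left std_gaussian_affine_moment)
      (auto simp: has_bochner_integral_iff std_gaussian.prob_space[simplified])
  then have "has_bochner_integral std_gaussian (\<lambda>z. log b (f (?W z, ?Y z))) (log b (norm y / norm r))"
    using r nz by simp
  then have "has_bochner_integral ?J (\<lambda>p. log b (f p)) (log b (norm y / norm r))"
    by (intro has_bochner_integral_distr) auto
  then have "integrable ?J (\<lambda>p. log b (f p))" "(\<integral>p. log b (f p) \<partial>?J) = log b (norm y / norm r)"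
    by (auto simp: has_bochner_integral_iff)
  moreover have "KL_divergence_ext b (?MW \<Otimes>\<^sub>M ?MY) ?J = ereal (\<integral>p. log b (f p) \<partial>?J)"
    using calculation(1) unfolding J
    by (intro KL_divergence_ext_density pos) (auto intro: P.sigma_finite_measure_axioms)
  ultimately show ?thesis by (simp add: mutual_info_def)
qed

end

section \<open>Change of variables and conditional mutual information\<close>

text \<open>A measurable left inverse means that \<open>T\<close> loses no information: absolute
  continuity can be pulled back as well as pushed forward, and the Radon-Nikodym derivatives
  correspond under composition with \<open>T\<close>.\<close>

lemma KL_divergence_ext_distr:
  assumes "sigma_finite_measure M" and N: "sets N = sets M"
    and T: "T \<in> M \<rightarrow>\<^sub>M M'" and T': "T' \<in> M' \<rightarrow>\<^sub>M M" and inv: "\<And>x. x \<in> space M \<Longrightarrow> T' (T x) = x"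
  shows "KL_divergence_ext b (distr M M' T) (distr N M' T) = KL_divergence_ext b M N"
proof -
  interpret sigma_finite_measure M by fact
  let ?M = "distr M M' T" and ?N = "distr N M' T"
  note [measurable] = T T'
  have sp: "space N = space M" by (rule sets_eq_imp_space_eq[OF N])
  have TN[measurable]: "T \<in> N \<rightarrow>\<^sub>M M'" using T by (simp add: measurable_cong_sets[OF N refl])
  have ac: "absolutely_continuous ?M ?N \<longleftrightarrow> absolutely_continuous M N"
  proof
    assume ac: "absolutely_continuous ?M ?N"
    show "absolutely_continuous M N"
      unfolding absolutely_continuous_def
    proof
      fix A assume A: "A \<in> null_sets M"
      \<comment> \<open>A measurable set whose preimage under \<open>T\<close> is again
        \<open>A\<close>.\<close>
      let ?B = "T' -` A \<inter> space M'"
      have "A \<in> sets M" using A by auto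
      then have B: "?B \<in> sets M'" by simp
      have pre: "T -` ?B \<inter> space M = A"
        using inv sets.sets_into_space[OF \<open>A \<in> sets M\<close>] measurable_space[OF T] by auto
      have "?B \<in> null_sets ?M"
        using A B pre by (auto simp: null_sets_def emeasure_distr)
      then have "?B \<in> null_sets ?N" using ac by (auto simp: absolutely_continuous_def)
      then have "emeasure N A = 0"
        using B pre by (auto simp: null_sets_def emeasure_distr sp)
      then show "A \<in> null_sets N" using \<open>A \<in> sets M\<close> N by auto
    qed
  next
    assume ac: "absolutely_continuous M N"
    show "absolutely_continuous ?M ?N"
      unfolding absolutely_continuous_def
    proof
      fix A assume A: "A \<in> null_sets ?M"
      then have "T -` A \<inter> space M \<in> null_sets M"
        by (auto simp: null_sets_def emeasure_distr)
      then have "T -` A \<inter> space M \<in> null_sets N" using ac by (auto simp: absolutely_continuous_def)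
      then show "A \<in> null_sets ?N" using A by (auto simp: null_sets_def emeasure_distr sp)
    qed
  qed
  show ?thesis
  proof (cases "absolutely_continuous M N")
    case True
    have "AE x in M. RN_deriv ?M ?N (T x) = RN_deriv M N x"
      by (rule RN_deriv_distr[OF T T']) (use inv ac True N in auto)
    then have "AE x in N. RN_deriv ?M ?N (T x) = RN_deriv M N x"
      by (rule absolutely_continuous_AE[OF N True])
    then have AE: "AE x in N. entropy_density b ?M ?N (T x) = entropy_density b M N x"
      by eventually_elim (simp add: entropy_density_def)
    have [measurable]: "entropy_density b M N \<in> borel_measurable N"
      using measurable_entropy_density[of b M N] by (simp add: measurable_cong_sets[OF N refl])
    have [measurable]: "entropy_density b ?M ?N \<in> borel_measurable M'"
      using measurable_entropy_density[of b ?M ?N] by simp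
    have "integrable ?N (entropy_density b ?M ?N) \<longleftrightarrow> integrable N (entropy_density b M N)"
      by (subst integrable_distr_eq, simp, simp, rule integrable_cong_AE) (auto simp: AE)
    moreover have "KL_divergence b ?M ?N = KL_divergence b M N"
      unfolding KL_divergence_def by (subst integral_distr) (auto intro!: integral_cong_AE AE)
    ultimately show ?thesis by (simp add: KL_divergence_ext_def ac)
  qed (simp add: KL_divergence_ext_def ac)
qed

lemma nn_integral_bind_Pair:
  assumes K: "K \<in> R \<rightarrow>\<^sub>M prob_algebra S" and \<mu>: "sets \<mu> = sets R"
    and h[measurable]: "h \<in> borel_measurable (R \<Otimes>\<^sub>M S)"
  shows "(\<integral>\<^sup>+p. h p \<partial>(\<mu> \<bind> (\<lambda>z. K z \<bind> (\<lambda>x. return (R \<Otimes>\<^sub>M S) (z, x))))) = (\<integral>\<^sup>+z. \<integral>\<^sup>+x. h (z, x) \<partial>K z \<partial>\<mu>)"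
proof -
  note [measurable] = K measurable_prob_algebraD[OF K] and [measurable_cong] = \<mu>
  have "(\<integral>\<^sup>+p. h p \<partial>(\<mu> \<bind> (\<lambda>z. K z \<bind> (\<lambda>x. return (R \<Otimes>\<^sub>M S) (z, x)))))
      = (\<integral>\<^sup>+z. \<integral>\<^sup>+p. h p \<partial>(K z \<bind> (\<lambda>x. return (R \<Otimes>\<^sub>M S) (z, x))) \<partial>\<mu>)"
    by (rule nn_integral_bind[OF h]) measurable
  also have "\<dots> = (\<integral>\<^sup>+z. \<integral>\<^sup>+x. h (z, x) \<partial>K z \<partial>\<mu>)"
  proof (rule nn_integral_cong)
    fix z assume "z \<in> space \<mu>"
    then have z: "z \<in> space R" using sets_eq_imp_space_eq[OF \<mu>] by simp
    have Kz[measurable_cong]: "sets (K z) = sets S"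
      using measurable_space[OF K z] by (simp add: space_prob_algebra)
    note [measurable] = measurable_ident_sets[OF Kz]
    have "(\<integral>\<^sup>+p. h p \<partial>(K z \<bind> (\<lambda>x. return (R \<Otimes>\<^sub>M S) (z, x)))) =
        (\<integral>\<^sup>+x. \<integral>\<^sup>+p. h p \<partial>return (R \<Otimes>\<^sub>M S) (z, x) \<partial>K z)"
      by (rule nn_integral_bind[OF h]) (use z in measurable)
    also have "\<dots> = (\<integral>\<^sup>+x. h (z, x) \<partial>K z)"
      by (rule nn_integral_cong, subst nn_integral_return)
        (use z sets_eq_imp_space_eq[OF Kz] in \<open>auto simp: space_pair_measure\<close>)
    finally show "(\<integral>\<^sup>+p. h p \<partial>(K z \<bind> (\<lambda>x. return (R \<Otimes>\<^sub>M S) (z, x)))) = (\<integral>\<^sup>+x. h (z, x) \<partial>K z)" .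
  qed
  finally show ?thesis .
qed

text \<open>A conditional distribution is only
  determined up to null sets, so it is compared with the law of \<open>Y\<close> one event at a time.\<close>

lemma cond_mutual_info_indep:
  assumes "prob_space M" and [measurable]: "X \<in> M \<rightarrow>\<^sub>M S" "Y \<in> M \<rightarrow>\<^sub>M T" "Z \<in> M \<rightarrow>\<^sub>M R"
    and indep: "distr M (R \<Otimes>\<^sub>M T) (\<lambda>\<omega>. (Z \<omega>, Y \<omega>)) = distr M R Z \<Otimes>\<^sub>M distr M T Y"
    and ex: "is_cond_distr M S R X Z K0"
  shows "cond_mutual_info b M S T R X Y Z = mutual_info b M (R \<Otimes>\<^sub>M S) T (\<lambda>\<omega>. (Z \<omega>, X \<omega>)) Y"
proof -
  interpret prob_space M by fact
  let ?MZ = "distr M R Z" and ?MY = "distr M T Y"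
  let ?MZX = "distr M (R \<Otimes>\<^sub>M S) (\<lambda>\<omega>. (Z \<omega>, X \<omega>))"
  interpret MZ: prob_space ?MZ by (rule prob_space_distr) simp
  interpret MY: prob_space ?MY by (rule prob_space_distr) simp
  interpret MZX: prob_space ?MZX by (rule prob_space_distr) simp
  interpret ZY: pair_prob_space ?MZ ?MY ..
  interpret ZXY: pair_prob_space ?MZX ?MY ..
  define K where "K = cond_distr M S R X Z"
  define L where "L = cond_distr M T R Y Z"
  have "is_cond_distr M S R X Z K"
    unfolding K_def cond_distr_def by (rule someI[of "is_cond_distr M S R X Z", OF ex])
  then have K[measurable]: "K \<in> R \<rightarrow>\<^sub>M prob_algebra S"
    and K_eq: "?MZX = ?MZ \<bind> (\<lambda>z. K z \<bind> (\<lambda>x. return (R \<Otimes>\<^sub>M S) (z, x)))"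
    by (auto simp: is_cond_distr_def)
  have MY_in: "?MY \<in> space (prob_algebra T)"
    by (auto simp: space_prob_algebra MY.prob_space_axioms)
  \<comment> \<open>By independence the constant kernel is a conditional distribution, so the chosen
    \<open>L\<close> satisfies a defining equation as well.\<close>
  have "is_cond_distr M T R Y Z (\<lambda>_. ?MY)"
    unfolding is_cond_distr_def
  proof
    show "(\<lambda>_. ?MY) \<in> R \<rightarrow>\<^sub>M prob_algebra T" using MY_in by simp
    have "return (?MZ \<Otimes>\<^sub>M ?MY) = return (R \<Otimes>\<^sub>M T)"
      by (intro return_sets_cong sets_pair_measure_cong) auto
    then show "distr M (R \<Otimes>\<^sub>M T) (\<lambda>\<omega>. (Z \<omega>, Y \<omega>)) = ?MZ \<bind> (\<lambda>z. ?MY \<bind> (\<lambda>y. return (R \<Otimes>\<^sub>M T) (z, y)))"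
      using ZY.pair_measure_eq_bind indep by simp
  qed
  then have "is_cond_distr M T R Y Z L"
    unfolding L_def cond_distr_def by (rule someI[of "is_cond_distr M T R Y Z"])
  then have L[measurable]: "L \<in> R \<rightarrow>\<^sub>M prob_algebra T"
    and L_eq: "?MZ \<Otimes>\<^sub>M ?MY = ?MZ \<bind> (\<lambda>z. L z \<bind> (\<lambda>x. return (R \<Otimes>\<^sub>M T) (z, x)))"
    by (auto simp: is_cond_distr_def indep)
  note [measurable] = measurable_prob_algebraD[OF K] measurable_prob_algebraD[OF L]
  have sK: "sets (K z) = sets S" and sL: "sets (L z) = sets T" if "z \<in> space R" for z
    using that measurable_space[OF K] measurable_space[OF L] by (auto simp: space_prob_algebra)

  have L_AE: "AE z in ?MZ. emeasure (L z) C = emeasure ?MY C" if C[measurable]: "C \<in> sets T" for C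
  proof -
    \<comment> \<open>Both densities give the same mass to every event of \<open>Z\<close>, so they
      agree almost everywhere. The exceptional set may depend on \<open>C\<close>.\<close>
    have "density ?MZ (\<lambda>z. emeasure (L z) C) = density ?MZ (\<lambda>_. emeasure ?MY C)"
    proof (rule measure_eqI)
      fix A assume "A \<in> sets (density ?MZ (\<lambda>z. emeasure (L z) C))"
      then have A[measurable]: "A \<in> sets R" by simp
      have "emeasure ?MZ A * emeasure ?MY C = (\<integral>\<^sup>+p. indicator (A \<times> C) p \<partial>(?MZ \<Otimes>\<^sub>M ?MY))"
        by (simp add: MY.emeasure_pair_measure_Times)
      also have "\<dots> = (\<integral>\<^sup>+z. \<integral>\<^sup>+y. indicator (A \<times> C) (z, y) \<partial>L z \<partial>?MZ)"
        unfolding L_eq by (rule nn_integral_bind_Pair) auto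
      also have "\<dots> = (\<integral>\<^sup>+z. emeasure (L z) C * indicator A z \<partial>?MZ)"
      proof (rule nn_integral_cong)
        fix z assume "z \<in> space ?MZ"
        then show "(\<integral>\<^sup>+y. indicator (A \<times> C) (z, y) \<partial>L z) = emeasure (L z) C * indicator A z"
          by (cases "z \<in> A") (auto simp: indicator_times sL)
      qed
      finally show "emeasure (density ?MZ (\<lambda>z. emeasure (L z) C)) A = emeasure (density ?MZ (\<lambda>_. emeasure ?MY C)) A"
        by (simp add: emeasure_density nn_integral_cmult_indicator) (simp add: mult.commute)
    qed simp
    then show ?thesis
      by (subst (asm) MZ.density_unique_iff) auto
  qed

  define ref where "ref = ?MZ \<bind> (\<lambda>z. K z \<bind> (\<lambda>x. L z \<bind> (\<lambda>y. return (R \<Otimes>\<^sub>M (S \<Otimes>\<^sub>M T)) (z, x, y))))"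
  have ref_sets[measurable_cong, simp]: "sets ref = sets (R \<Otimes>\<^sub>M (S \<Otimes>\<^sub>M T))"
    unfolding ref_def
    by (rule sets_bind'[where M=R]) (auto simp: space_prob_algebra MZ.prob_space_axioms)
  have nn_ref: "(\<integral>\<^sup>+p. h p \<partial>ref) = (\<integral>\<^sup>+z. \<integral>\<^sup>+x. \<integral>\<^sup>+y. h (z, x, y) \<partial>L z \<partial>K z \<partial>?MZ)"
    if h[measurable]: "h \<in> borel_measurable (R \<Otimes>\<^sub>M (S \<Otimes>\<^sub>M T))" for h
  proof -
    have "(\<integral>\<^sup>+p. h p \<partial>ref) = (\<integral>\<^sup>+z. \<integral>\<^sup>+p. h p \<partial>(K z \<bind> (\<lambda>x. L z \<bind> (\<lambda>y. return (R \<Otimes>\<^sub>M (S \<Otimes>\<^sub>M T)) (z, x, y)))) \<partial>?MZ)"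
      unfolding ref_def by (rule nn_integral_bind[OF h]) measurable
    also have "\<dots> = (\<integral>\<^sup>+z. \<integral>\<^sup>+x. \<integral>\<^sup>+y. h (z, x, y) \<partial>L z \<partial>K z \<partial>?MZ)"
    proof (rule nn_integral_cong)
      fix z assume "z \<in> space ?MZ"
      then have z[measurable]: "z \<in> space R" by simp
      note [measurable_cong] = sK[OF z] sL[OF z]
        and [measurable] = measurable_ident_sets[OF sK[OF z]] measurable_ident_sets[OF sL[OF z]]
      have Lz: "L z \<in> space (subprob_algebra T)"
        using measurable_space[OF measurable_prob_algebraD[OF L] z] .
      have "(\<integral>\<^sup>+p. h p \<partial>(K z \<bind> (\<lambda>x. L z \<bind> (\<lambda>y. return (R \<Otimes>\<^sub>M (S \<Otimes>\<^sub>M T)) (z, x, y))))) =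
          (\<integral>\<^sup>+x. \<integral>\<^sup>+p. h p \<partial>(L z \<bind> (\<lambda>y. return (R \<Otimes>\<^sub>M (S \<Otimes>\<^sub>M T)) (z, x, y))) \<partial>K z)"
      proof (rule nn_integral_bind[OF h])
        have "(\<lambda>x. L z \<bind> (\<lambda>y. return (R \<Otimes>\<^sub>M (S \<Otimes>\<^sub>M T)) (z, x, y))) \<in> S \<rightarrow>\<^sub>M subprob_algebra (R \<Otimes>\<^sub>M (S \<Otimes>\<^sub>M T))"
          by (rule measurable_bind[where N = T]) (use Lz in simp, measurable)
        then show "(\<lambda>x. L z \<bind> (\<lambda>y. return (R \<Otimes>\<^sub>M (S \<Otimes>\<^sub>M T)) (z, x, y))) \<in> K z \<rightarrow>\<^sub>M subprob_algebra (R \<Otimes>\<^sub>M (S \<Otimes>\<^sub>M T))"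
          by (simp add: measurable_cong_sets[OF sK[OF z] refl])
      qed
      also have "\<dots> = (\<integral>\<^sup>+x. \<integral>\<^sup>+y. h (z, x, y) \<partial>L z \<partial>K z)"
      proof (rule nn_integral_cong)
        fix x assume "x \<in> space (K z)"
        then have x[measurable]: "x \<in> space S" using sets_eq_imp_space_eq[OF sK[OF z]] by simp
        have "(\<integral>\<^sup>+p. h p \<partial>(L z \<bind> (\<lambda>y. return (R \<Otimes>\<^sub>M (S \<Otimes>\<^sub>M T)) (z, x, y)))) =
            (\<integral>\<^sup>+y. \<integral>\<^sup>+p. h p \<partial>return (R \<Otimes>\<^sub>M (S \<Otimes>\<^sub>M T)) (z, x, y) \<partial>L z)"
          by (rule nn_integral_bind[OF h]) measurable
        also have "\<dots> = (\<integral>\<^sup>+y. h (z, x, y) \<partial>L z)"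
          by (rule nn_integral_cong, subst nn_integral_return)
            (use z x sets_eq_imp_space_eq[OF sL[OF z]] in \<open>auto simp: space_pair_measure\<close>)
        finally show "(\<integral>\<^sup>+p. h p \<partial>(L z \<bind> (\<lambda>y. return (R \<Otimes>\<^sub>M (S \<Otimes>\<^sub>M T)) (z, x, y)))) = (\<integral>\<^sup>+y. h (z, x, y) \<partial>L z)" .
      qed
      finally show "(\<integral>\<^sup>+p. h p \<partial>(K z \<bind> (\<lambda>x. L z \<bind> (\<lambda>y. return (R \<Otimes>\<^sub>M (S \<Otimes>\<^sub>M T)) (z, x, y))))) =
          (\<integral>\<^sup>+x. \<integral>\<^sup>+y. h (z, x, y) \<partial>L z \<partial>K z)" .
    qed
    finally show ?thesis .
  qed

  \<comment> \<open>Mutually inverse rebracketings of triples. They turn the reference law of the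
    conditional information into the product law of \<open>(Z, X)\<close> and
    \<open>Y\<close>.\<close>
  let ?g = "\<lambda>p. ((fst p, fst (snd p)), snd (snd p))" and ?g' = "\<lambda>p. (fst (fst p), snd (fst p), snd p)"
  have g[measurable]: "?g \<in> R \<Otimes>\<^sub>M (S \<Otimes>\<^sub>M T) \<rightarrow>\<^sub>M (R \<Otimes>\<^sub>M S) \<Otimes>\<^sub>M T" by measurable
  have g'[measurable]: "?g' \<in> (R \<Otimes>\<^sub>M S) \<Otimes>\<^sub>M T \<rightarrow>\<^sub>M R \<Otimes>\<^sub>M (S \<Otimes>\<^sub>M T)" by measurable
  \<comment> \<open>A product measure is determined by rectangles, so a single event
    \<open>C\<close> occurs at a time and the exceptional sets need not be merged.\<close>
  have prod: "?MZX \<Otimes>\<^sub>M ?MY = distr ref ((R \<Otimes>\<^sub>M S) \<Otimes>\<^sub>M T) ?g"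
  proof (rule pair_measure_eqI)
    fix A C assume "A \<in> sets ?MZX" "C \<in> sets ?MY"
    then have A[measurable]: "A \<in> sets (R \<Otimes>\<^sub>M S)" and C[measurable]: "C \<in> sets T" by auto
    have "emeasure (distr ref ((R \<Otimes>\<^sub>M S) \<Otimes>\<^sub>M T) ?g) (A \<times> C) = (\<integral>\<^sup>+p. indicator (A \<times> C) (?g p) \<partial>ref)"
      by (subst nn_integral_indicator[symmetric], simp, subst nn_integral_distr) auto
    also have "\<dots> = (\<integral>\<^sup>+z. \<integral>\<^sup>+x. \<integral>\<^sup>+y. indicator A (z, x) * indicator C y \<partial>L z \<partial>K z \<partial>?MZ)"
      by (subst nn_ref) (auto simp: indicator_times)
    also have "\<dots> = (\<integral>\<^sup>+z. (\<integral>\<^sup>+x. indicator A (z, x) \<partial>K z) * emeasure (L z) C \<partial>?MZ)"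
    proof (rule nn_integral_cong)
      fix z assume "z \<in> space ?MZ"
      then have z[measurable]: "z \<in> space R" by simp
      note [measurable_cong] = sK[OF z] sL[OF z]
        and [measurable] = measurable_ident_sets[OF sK[OF z]] measurable_ident_sets[OF sL[OF z]]
      show "(\<integral>\<^sup>+x. \<integral>\<^sup>+y. indicator A (z, x) * indicator C y \<partial>L z \<partial>K z) = (\<integral>\<^sup>+x. indicator A (z, x) \<partial>K z) * emeasure (L z) C"
        by (simp add: nn_integral_cmult nn_integral_multc sL[OF z])
    qed
    also have "\<dots> = (\<integral>\<^sup>+z. (\<integral>\<^sup>+x. indicator A (z, x) \<partial>K z) * emeasure ?MY C \<partial>?MZ)"
      using L_AE[OF C] by (intro nn_integral_cong_AE) (auto elim!: eventually_mono)
    also have "\<dots> = (\<integral>\<^sup>+z. \<integral>\<^sup>+x. indicator A (z, x) \<partial>K z \<partial>?MZ) * emeasure ?MY C"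
      by (rule nn_integral_multc)
        (simp, rule nn_integral_measurable_subprob_algebra2[OF _ measurable_prob_algebraD[OF K]], measurable)
    also have "(\<integral>\<^sup>+z. \<integral>\<^sup>+x. indicator A (z, x) \<partial>K z \<partial>?MZ) = (\<integral>\<^sup>+p. indicator A p \<partial>?MZX)"
      unfolding K_eq by (rule nn_integral_bind_Pair[symmetric]) auto
    also have "\<dots> = emeasure ?MZX A" by simp
    finally show "emeasure ?MZX A * emeasure ?MY C = emeasure (distr ref ((R \<Otimes>\<^sub>M S) \<Otimes>\<^sub>M T) ?g) (A \<times> C)" by simp
  qed (auto intro: MZX.sigma_finite_measure_axioms MY.sigma_finite_measure_axioms cong: sets_pair_measure_cong)
  have "cond_mutual_info b M S T R X Y Z =
      KL_divergence_ext b ref (distr M (R \<Otimes>\<^sub>M (S \<Otimes>\<^sub>M T)) (\<lambda>\<omega>. (Z \<omega>, X \<omega>, Y \<omega>)))"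
    unfolding cond_mutual_info_def ref_def K_def L_def ..
  also have "ref = distr (?MZX \<Otimes>\<^sub>M ?MY) (R \<Otimes>\<^sub>M (S \<Otimes>\<^sub>M T)) ?g'"
    unfolding prod by (subst distr_distr) (auto simp: comp_def case_prod_beta distr_id2)
  also have "distr M (R \<Otimes>\<^sub>M (S \<Otimes>\<^sub>M T)) (\<lambda>\<omega>. (Z \<omega>, X \<omega>, Y \<omega>)) =
      distr (distr M ((R \<Otimes>\<^sub>M S) \<Otimes>\<^sub>M T) (\<lambda>\<omega>. ((Z \<omega>, X \<omega>), Y \<omega>))) (R \<Otimes>\<^sub>M (S \<Otimes>\<^sub>M T)) ?g'"
    by (subst distr_distr) (auto simp: comp_def)
  also have "KL_divergence_ext b (distr (?MZX \<Otimes>\<^sub>M ?MY) (R \<Otimes>\<^sub>M (S \<Otimes>\<^sub>M T)) ?g') \<dots> =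
      KL_divergence_ext b (?MZX \<Otimes>\<^sub>M ?MY) (distr M ((R \<Otimes>\<^sub>M S) \<Otimes>\<^sub>M T) (\<lambda>\<omega>. ((Z \<omega>, X \<omega>), Y \<omega>)))"
    by (rule KL_divergence_ext_distr[where T' = ?g])
      (auto intro: ZXY.sigma_finite_measure_axioms simp: space_pair_measure cong: sets_pair_measure_cong)
  finally show ?thesis unfolding mutual_info_def .
qed

subsection \<open>The joint law of a policy\<close>

lemma sets_centered_normal [simp, measurable_cong]: "sets (centered_normal v) = sets borel"
  by (simp add: centered_normal_def)

lemma space_centered_normal [simp]: "space (centered_normal v) = UNIV"
  by (simp add: centered_normal_def)

lemma prob_space_centered_normal: "v > 0 \<Longrightarrow> prob_space (centered_normal v)"
  unfolding centered_normal_def by (rule prob_space_normal_density) simp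

section \<open>Composition of kernels and coordinates of the outcome\<close>

lemma measurable_kernel_bind:
  fixes K :: "'a::second_countable_topology \<Rightarrow> 'b::second_countable_topology measure"
  assumes "K \<in> borel \<rightarrow>\<^sub>M prob_algebra borel" and "L \<in> borel \<rightarrow>\<^sub>M prob_algebra R"
  shows "(\<lambda>x. K x \<bind> (\<lambda>y. L (x, y))) \<in> borel \<rightarrow>\<^sub>M prob_algebra R"
  using assms by (intro measurable_bind_prob_space2[where N = borel]) (simp_all add: borel_prod)

lemma nn_integral_kernel_bind:
  fixes \<mu> :: "'b::second_countable_topology measure" and x :: "'a::second_countable_topology"
  assumes \<mu>: "sets \<mu> = sets borel" and L: "L \<in> borel \<rightarrow>\<^sub>M prob_algebra R" and f: "f \<in> borel_measurable R"
  shows "(\<integral>\<^sup>+p. f p \<partial>(\<mu> \<bind> (\<lambda>y. L (x, y)))) = (\<integral>\<^sup>+y. \<integral>\<^sup>+p. f p \<partial>L (x, y) \<partial>\<mu>)"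
proof (rule nn_integral_bind[OF f])
  have "(\<lambda>y. L (x, y)) \<in> borel \<rightarrow>\<^sub>M subprob_algebra R"
    by (rule measurable_compose[OF _ measurable_prob_algebraD[OF L]]) measurable
  then show "(\<lambda>y. L (x, y)) \<in> \<mu> \<rightarrow>\<^sub>M subprob_algebra R"
    by (simp add: measurable_cong_sets[OF \<mu> refl])
qed

lemma channel_bind:
  fixes g :: "_ \<Rightarrow> 'c measure"
  assumes g[measurable]: "g \<in> borel \<rightarrow>\<^sub>M prob_algebra R"
  shows "channel N (x0, u1) \<bind> g = centered_normal N \<bind> (\<lambda>z. g (x0 + u1, x0 + u1 + z))"
proof -
  note [measurable] = measurable_prob_algebraD[OF g]
  show ?thesis
    unfolding channel_def Let_def split
    by (subst bind_assoc[where N=borel and R=R]) (auto simp: bind_return[OF measurable_prob_algebraD[OF g]])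
qed

lemma outcome_simps:
  "X0 (x0, w1, w2, u1, x1, y1, u2) = x0" "W1 (x0, w1, w2, u1, x1, y1, u2) = w1"
  "W2 (x0, w1, w2, u1, x1, y1, u2) = w2" "U1 (x0, w1, w2, u1, x1, y1, u2) = u1"
  "X1 (x0, w1, w2, u1, x1, y1, u2) = x1" "Y1 (x0, w1, w2, u1, x1, y1, u2) = y1"
  "U2 (x0, w1, w2, u1, x1, y1, u2) = u2"
  by (simp_all add: X0_def W1_def W2_def U1_def X1_def Y1_def U2_def)

lemma outcome_linear:
  "linear X0" "linear W1" "linear W2" "linear U1" "linear X1" "linear Y1" "linear U2"
  by (auto intro!: linearI simp: outcome_simps)

lemma outcome_measurable [measurable]:
  "X0 \<in> borel_measurable borel" "W1 \<in> borel_measurable borel" "W2 \<in> borel_measurable borel"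
  "U1 \<in> borel_measurable borel" "X1 \<in> borel_measurable borel" "Y1 \<in> borel_measurable borel"
  "U2 \<in> borel_measurable borel"
  using outcome_linear
  by (auto intro!: borel_measurable_continuous_onI linear_continuous_on simp: linear_conv_bounded_linear)

section \<open>The joint law as an iterated integral\<close>

locale policy_law =
  fixes Q N :: real and PW1 :: "real measure" and KW2 KU1 :: "real \<times> real \<Rightarrow> real measure"
    and KU2 :: "real \<times> real \<times> real \<Rightarrow> real measure"
  assumes Q: "Q > 0" and N: "N > 0" and policy: "(PW1, KW2, KU1, KU2) \<in> policies"
begin

abbreviation J where "J \<equiv> joint_law Q N (PW1, KW2, KU1, KU2)"

lemma policy_measurable:
  "PW1 \<in> space (prob_algebra borel)" "KW2 \<in> borel \<rightarrow>\<^sub>M prob_algebra borel"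
  "KU1 \<in> borel \<rightarrow>\<^sub>M prob_algebra borel" "KU2 \<in> borel \<rightarrow>\<^sub>M prob_algebra borel"
  "centered_normal Q \<in> space (prob_algebra borel)" "centered_normal N \<in> space (prob_algebra borel)"
  using policy Q N by (auto simp: policies_def space_prob_algebra prob_space_centered_normal)

lemma policy_prob_space:
  "prob_space PW1" "prob_space (KW2 p)" "prob_space (KU1 p)" "prob_space (KU2 q)"
  using policy_measurable(1) measurable_space[OF policy_measurable(2), of p] measurable_space[OF policy_measurable(3), of p]
    measurable_space[OF policy_measurable(4), of q]
  by (auto simp: space_prob_algebra)

lemma policy_sets [simp, measurable_cong]:
  "sets PW1 = sets borel" "sets (KW2 p) = sets borel" "sets (KU1 p) = sets borel" "sets (KU2 q) = sets borel"
  using policy_measurable(1) measurable_space[OF policy_measurable(2), of p] measurable_space[OF policy_measurable(3), of p]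
    measurable_space[OF policy_measurable(4), of q]
  by (auto simp: space_prob_algebra)

lemma policy_space [simp]:
  "space PW1 = UNIV" "space (KW2 p) = UNIV" "space (KU1 p) = UNIV" "space (KU2 q) = UNIV"
  by (auto simp: sets_eq_imp_space_eq[OF policy_sets(1)] sets_eq_imp_space_eq[OF policy_sets(2)]
     sets_eq_imp_space_eq[OF policy_sets(3)] sets_eq_imp_space_eq[OF policy_sets(4)])

text \<open>\<open>tail\<close>\<open>k\<close> maps the first \<open>k\<close> draws, nested to the left, to the conditional law of the outcome.\<close>

definition tail5 :: "((((real \<times> real) \<times> real) \<times> real) \<times> real) \<Rightarrow> outcome measure" where
  "tail5 = (\<lambda>((((x0, w1), w2), u1), z). KU2 (w1, w2, x0 + u1 + z) \<bind>
    (\<lambda>u2. return borel (x0, w1, w2, u1, x0 + u1, x0 + u1 + z, u2)))"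

definition tail4 where "tail4 = (\<lambda>p. centered_normal N \<bind> (\<lambda>z. tail5 (p, z)))"
definition tail3 where "tail3 = (\<lambda>p. KU1 (fst p) \<bind> (\<lambda>u1. tail4 (p, u1)))"
definition tail2 where "tail2 = (\<lambda>p. KW2 p \<bind> (\<lambda>w2. tail3 (p, w2)))"
definition tail1 where "tail1 = (\<lambda>x0. PW1 \<bind> (\<lambda>w1. tail2 (x0, w1)))"

lemma tail5_eq:
  "tail5 = (\<lambda>p. KU2 (snd (fst (fst (fst p))), snd (fst (fst p)), fst (fst (fst (fst p))) + snd (fst p) + snd p) \<bind>
    (\<lambda>u2. (\<lambda>(p, u2). return borel (fst (fst (fst (fst p))), snd (fst (fst (fst p))), snd (fst (fst p)), snd (fst p),
       fst (fst (fst (fst p))) + snd (fst p), fst (fst (fst (fst p))) + snd (fst p) + snd p, u2)) (p, u2)))"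
  by (auto simp: tail5_def fun_eq_iff)

lemma tail5_measurable: "tail5 \<in> borel \<rightarrow>\<^sub>M prob_algebra borel"
  unfolding tail5_eq case_prod_beta
  by (intro measurable_kernel_bind measurable_compose[OF _ policy_measurable(4)]
      measurable_compose[OF _ measurable_return_prob_space] borel_measurable_continuous_onI continuous_intros)

lemma tail4_measurable: "tail4 \<in> borel \<rightarrow>\<^sub>M prob_algebra borel"
  unfolding tail4_def by (intro measurable_kernel_bind tail5_measurable) (simp add: policy_measurable)

lemma tail3_measurable: "tail3 \<in> borel \<rightarrow>\<^sub>M prob_algebra borel"
  unfolding tail3_def
  by (intro measurable_kernel_bind tail4_measurable measurable_compose[OF _ policy_measurable(3)]
      borel_measurable_continuous_onI continuous_intros)

lemma tail2_measurable: "tail2 \<in> borel \<rightarrow>\<^sub>M prob_algebra borel"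
  unfolding tail2_def by (intro measurable_kernel_bind tail3_measurable policy_measurable)

lemma tail1_measurable: "tail1 \<in> borel \<rightarrow>\<^sub>M prob_algebra borel"
  unfolding tail1_def by (intro measurable_kernel_bind tail2_measurable) (simp add: policy_measurable)

text \<open>The sampling program becomes a chain of kernels, so that measurability and integration
  can be handled one draw at a time.\<close>

lemma joint_law_eq_bind_tail: "J = centered_normal Q \<bind> tail1"
proof -
  have "channel N (x0, u1) \<bind> (\<lambda>(x1, y1). KU2 (w1, w2, y1) \<bind> (\<lambda>u2. return borel (x0, w1, w2, u1, x1, y1, u2)))
     = tail4 (((x0, w1), w2), u1)" for x0 w1 w2 u1
  proof -
    have "(\<lambda>p::real \<times> real. KU2 (w1, w2, snd p) \<bind> (\<lambda>u2. return borel (x0, w1, w2, u1, fst (fst (p, u2)), snd (fst (p, u2)), snd (p, u2))))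
        \<in> borel \<rightarrow>\<^sub>M prob_algebra borel"
      by (rule measurable_kernel_bind[where L = "\<lambda>q. return borel (x0, w1, w2, u1, fst (fst q), snd (fst q), snd q)"])
        (intro measurable_compose[OF _ policy_measurable(4)] measurable_compose[OF _ measurable_return_prob_space]
          borel_measurable_continuous_onI continuous_intros)+
    then have "(\<lambda>(x1::real, y1). KU2 (w1, w2, y1) \<bind> (\<lambda>u2. return borel (x0, w1, w2, u1, x1, y1, u2)))
        \<in> borel \<rightarrow>\<^sub>M prob_algebra borel"
      by (simp add: case_prod_unfold)
    from channel_bind[OF this] show ?thesis by (simp add: tail4_def tail5_def)
  qed
  then show ?thesis
    by (simp add: joint_law_def tail1_def[abs_def] tail2_def tail3_def)
qed

lemma sets_joint_law [simp, measurable_cong]: "sets J = sets borel"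
  unfolding joint_law_eq_bind_tail by (rule sets_bind'[OF policy_measurable(5) tail1_measurable])

lemma prob_space_joint_law: "prob_space J"
  unfolding joint_law_eq_bind_tail by (rule prob_space_bind'[OF policy_measurable(5) tail1_measurable])

text \<open>Each draw contributes one integral, with \<open>X1\<close> and \<open>Y1\<close>
  replaced by their values. The marginals and independences of the joint law are read off from this
  formula.\<close>

lemma nn_integral_joint_law:
  assumes f: "f \<in> borel_measurable borel"
  shows "(\<integral>\<^sup>+\<omega>. f \<omega> \<partial>J) =
    (\<integral>\<^sup>+x0. \<integral>\<^sup>+w1. \<integral>\<^sup>+w2. \<integral>\<^sup>+u1. \<integral>\<^sup>+z. \<integral>\<^sup>+u2. f (x0, w1, w2, u1, x0 + u1, x0 + u1 + z, u2)
       \<partial>KU2 (w1, w2, x0 + u1 + z) \<partial>centered_normal N \<partial>KU1 (x0, w1) \<partial>KW2 (x0, w1) \<partial>PW1 \<partial>centered_normal Q)"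
proof -
  have tail5_int: "(\<integral>\<^sup>+\<omega>. f \<omega> \<partial>tail5 ((((x0, w1), w2), u1), z)) =
      (\<integral>\<^sup>+u2. f (x0, w1, w2, u1, x0 + u1, x0 + u1 + z, u2) \<partial>KU2 (w1, w2, x0 + u1 + z))" for x0 w1 w2 u1 z
  proof -
    have "(\<lambda>u2. return borel (x0, w1, w2, u1, x0 + u1, x0 + u1 + z, u2))
        \<in> KU2 (w1, w2, x0 + u1 + z) \<rightarrow>\<^sub>M subprob_algebra borel"
      by (rule measurable_compose[OF _ return_measurable]) measurable
    from nn_integral_bind[OF f this] show ?thesis
      by (simp add: tail5_def nn_integral_return f)
  qed
  have "tail1 \<in> centered_normal Q \<rightarrow>\<^sub>M subprob_algebra borel"
    using measurable_prob_algebraD[OF tail1_measurable] by (simp cong: measurable_cong_sets)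
  then have "(\<integral>\<^sup>+\<omega>. f \<omega> \<partial>J) = (\<integral>\<^sup>+x0. \<integral>\<^sup>+\<omega>. f \<omega> \<partial>tail1 x0 \<partial>centered_normal Q)"
    unfolding joint_law_eq_bind_tail by (rule nn_integral_bind[OF f])
  also have "\<dots> = (\<integral>\<^sup>+x0. \<integral>\<^sup>+w1. \<integral>\<^sup>+w2. \<integral>\<^sup>+u1. \<integral>\<^sup>+z. \<integral>\<^sup>+\<omega>. f \<omega> \<partial>tail5 ((((x0, w1), w2), u1), z)
       \<partial>centered_normal N \<partial>KU1 (x0, w1) \<partial>KW2 (x0, w1) \<partial>PW1 \<partial>centered_normal Q)"
    unfolding tail1_def nn_integral_kernel_bind[OF policy_sets(1) tail2_measurable f]
    unfolding tail2_def nn_integral_kernel_bind[OF policy_sets(2) tail3_measurable f]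
    unfolding tail3_def nn_integral_kernel_bind[OF policy_sets(3) tail4_measurable f]
    unfolding tail4_def nn_integral_kernel_bind[OF sets_centered_normal tail5_measurable f]
    by simp
  finally show ?thesis unfolding tail5_int .
qed

lemma policy_emeasure_UNIV [simp]:
  "emeasure PW1 UNIV = 1" "emeasure (KW2 p) UNIV = 1" "emeasure (KU1 p) UNIV = 1" "emeasure (KU2 q) UNIV = 1"
  "emeasure (centered_normal Q) UNIV = 1" "emeasure (centered_normal N) UNIV = 1"
  using policy_prob_space(1)[THEN prob_space.emeasure_space_1]
    policy_prob_space(2)[of p, THEN prob_space.emeasure_space_1]
    policy_prob_space(3)[of p, THEN prob_space.emeasure_space_1]
    policy_prob_space(4)[of q, THEN prob_space.emeasure_space_1]
    prob_space_centered_normal[OF Q, THEN prob_space.emeasure_space_1]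
    prob_space_centered_normal[OF N, THEN prob_space.emeasure_space_1]
  by auto

section \<open>Conditional independences and marginals of the joint law\<close>

text \<open>The integral form of the conditional independence of \<open>U1\<close> and
  \<open>W2\<close> given \<open>(X0, W1)\<close>: the kernel on the right does not depend on
  \<open>W2\<close>. The draws that do not enter integrate to 1.\<close>

lemma nn_integral_joint_law_U1:
  assumes h: "h \<in> borel_measurable borel"
  shows "(\<integral>\<^sup>+\<omega>. h (X0 \<omega>, W1 \<omega>, W2 \<omega>, U1 \<omega>) \<partial>J) =
    (\<integral>\<^sup>+\<omega>. \<integral>\<^sup>+u. h (X0 \<omega>, W1 \<omega>, W2 \<omega>, u) \<partial>KU1 (X0 \<omega>, W1 \<omega>) \<partial>J)"
proof -
  note [measurable] = policy_measurable(2-4) policy_measurable(2-4)[THEN measurable_prob_algebraD] h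
  have 1: "(\<lambda>\<omega>. h (X0 \<omega>, W1 \<omega>, W2 \<omega>, U1 \<omega>)) \<in> borel_measurable borel" by measurable
  have 2: "(\<lambda>\<omega>. \<integral>\<^sup>+u. h (X0 \<omega>, W1 \<omega>, W2 \<omega>, u) \<partial>KU1 (X0 \<omega>, W1 \<omega>)) \<in> borel_measurable borel"
    by (rule nn_integral_measurable_subprob_algebra2[where N = borel]) measurable
  show ?thesis
    unfolding nn_integral_joint_law[OF 1] nn_integral_joint_law[OF 2]
    by (simp add: outcome_simps)
qed

text \<open>The Markov property of the decoder: given \<open>(W1, W2, Y1)\<close>, the variables
  \<open>X0\<close> and \<open>U1\<close> have no further influence on \<open>U2\<close>.\<close>

lemma nn_integral_joint_law_U2:
  assumes h: "h \<in> borel_measurable borel"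
  shows "(\<integral>\<^sup>+\<omega>. h (X0 \<omega>, W1 \<omega>, W2 \<omega>, U1 \<omega>, Y1 \<omega>, U2 \<omega>) \<partial>J) =
    (\<integral>\<^sup>+\<omega>. \<integral>\<^sup>+u. h (X0 \<omega>, W1 \<omega>, W2 \<omega>, U1 \<omega>, Y1 \<omega>, u) \<partial>KU2 (W1 \<omega>, W2 \<omega>, Y1 \<omega>) \<partial>J)"
proof -
  note [measurable] = policy_measurable(2-4) policy_measurable(2-4)[THEN measurable_prob_algebraD] h
  have 1: "(\<lambda>\<omega>. h (X0 \<omega>, W1 \<omega>, W2 \<omega>, U1 \<omega>, Y1 \<omega>, U2 \<omega>)) \<in> borel_measurable borel" by measurable
  have 2: "(\<lambda>\<omega>. \<integral>\<^sup>+u. h (X0 \<omega>, W1 \<omega>, W2 \<omega>, U1 \<omega>, Y1 \<omega>, u) \<partial>KU2 (W1 \<omega>, W2 \<omega>, Y1 \<omega>)) \<in> borel_measurable borel"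
    by (rule nn_integral_measurable_subprob_algebra2[where N = borel]) measurable
  show ?thesis
    unfolding nn_integral_joint_law[OF 1] nn_integral_joint_law[OF 2]
    by (simp add: outcome_simps)
qed

text \<open>The difference \<open>Y1 - X1\<close> is the channel noise, drawn afresh after the other
  four variables.\<close>

lemma nn_integral_joint_law_noise:
  assumes h: "h \<in> borel_measurable borel"
  shows "(\<integral>\<^sup>+\<omega>. h (X0 \<omega>, W1 \<omega>, W2 \<omega>, U1 \<omega>, Y1 \<omega> - X1 \<omega>) \<partial>J) =
    (\<integral>\<^sup>+\<omega>. \<integral>\<^sup>+z. h (X0 \<omega>, W1 \<omega>, W2 \<omega>, U1 \<omega>, z) \<partial>centered_normal N \<partial>J)"
proof -
  note [measurable] = h
  interpret cN: prob_space "centered_normal N" by (rule prob_space_centered_normal[OF N])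
  have 1: "(\<lambda>\<omega>. h (X0 \<omega>, W1 \<omega>, W2 \<omega>, U1 \<omega>, Y1 \<omega> - X1 \<omega>)) \<in> borel_measurable borel" by measurable
  have 2: "(\<lambda>\<omega>. \<integral>\<^sup>+z. h (X0 \<omega>, W1 \<omega>, W2 \<omega>, U1 \<omega>, z) \<partial>centered_normal N) \<in> borel_measurable borel"
    by measurable
  show ?thesis
    unfolding nn_integral_joint_law[OF 1] nn_integral_joint_law[OF 2]
    by (simp add: outcome_simps)
qed

lemma AE_joint_law_X1: "AE \<omega> in J. X1 \<omega> = X0 \<omega> + U1 \<omega>"
proof -
  let ?A = "{\<omega>. X1 \<omega> \<noteq> X0 \<omega> + U1 \<omega>}"
  have A[measurable]: "?A \<in> sets borel" by measurable
  have "emeasure J ?A = (\<integral>\<^sup>+\<omega>. indicator ?A \<omega> \<partial>J)" by simp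
  also have "\<dots> = 0"
    by (subst nn_integral_joint_law) (auto simp: outcome_simps)
  finally show ?thesis by (intro AE_I[where N = ?A]) (auto simp: sets_eq_imp_space_eq[OF sets_joint_law])
qed

lemma distr_joint_law_X0: "distr J borel X0 = centered_normal Q"
proof (rule measure_eqI)
  fix A assume "A \<in> sets (distr J borel X0)"
  then have [measurable]: "A \<in> sets borel" by simp
  have "emeasure (distr J borel X0) A = (\<integral>\<^sup>+\<omega>. indicator A (X0 \<omega>) \<partial>J)"
    by (subst nn_integral_indicator[symmetric], simp, subst nn_integral_distr) auto
  also have "\<dots> = emeasure (centered_normal Q) A"
    by (subst nn_integral_joint_law) (auto simp: outcome_simps)
  finally show "emeasure (distr J borel X0) A = emeasure (centered_normal Q) A" .
qed simp

lemma distr_joint_law_W1: "distr J borel W1 = PW1"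
proof (rule measure_eqI)
  fix A assume "A \<in> sets (distr J borel W1)"
  then have [measurable]: "A \<in> sets borel" by simp
  have "emeasure (distr J borel W1) A = (\<integral>\<^sup>+\<omega>. indicator A (W1 \<omega>) \<partial>J)"
    by (subst nn_integral_indicator[symmetric], simp, subst nn_integral_distr) auto
  also have "\<dots> = emeasure PW1 A"
    by (subst nn_integral_joint_law) (auto simp: outcome_simps)
  finally show "emeasure (distr J borel W1) A = emeasure PW1 A" .
qed simp

lemma joint_law_indep:
  "distr J (borel \<Otimes>\<^sub>M borel) (\<lambda>\<omega>. (W1 \<omega>, X0 \<omega>)) = distr J borel W1 \<Otimes>\<^sub>M distr J borel X0"
proof (rule pair_measure_eqI[symmetric])
  interpret cQ: prob_space "centered_normal Q" by (rule prob_space_centered_normal[OF Q])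
  interpret PW1: prob_space PW1 by (rule policy_prob_space)
  show "sigma_finite_measure (distr J borel W1)" "sigma_finite_measure (distr J borel X0)"
    unfolding distr_joint_law_X0 distr_joint_law_W1
    by (rule PW1.sigma_finite_measure_axioms cQ.sigma_finite_measure_axioms)+
  fix A B assume "A \<in> sets (distr J borel W1)" "B \<in> sets (distr J borel X0)"
  then have [measurable]: "A \<in> sets borel" "B \<in> sets borel" by auto
  have "emeasure (distr J (borel \<Otimes>\<^sub>M borel) (\<lambda>\<omega>. (W1 \<omega>, X0 \<omega>))) (A \<times> B) = (\<integral>\<^sup>+\<omega>. indicator A (W1 \<omega>) * indicator B (X0 \<omega>) \<partial>J)"
    by (subst nn_integral_indicator[symmetric], simp, subst nn_integral_distr) (auto simp: indicator_times)
  also have "\<dots> = emeasure PW1 A * emeasure (centered_normal Q) B"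
    by (subst nn_integral_joint_law) (auto simp: outcome_simps nn_integral_multc nn_integral_cmult)
  finally show "emeasure (distr J borel W1) A * emeasure (distr J borel X0) B =
    emeasure (distr J (borel \<Otimes>\<^sub>M borel) (\<lambda>\<omega>. (W1 \<omega>, X0 \<omega>))) (A \<times> B)"
    by (simp add: distr_joint_law_X0 distr_joint_law_W1)
qed (simp cong: sets_pair_measure_cong)

text \<open>This witness makes the choice in \<open>cond_distr\<close> meaningful. Averaging
  \<open>KW2\<close> over the prior of \<open>X0\<close> is correct because \<open>X0\<close> is
  independent of \<open>W1\<close>; Fubini exchanges the two draws.\<close>

lemma joint_law_cond_distr:
  "is_cond_distr J borel borel W2 W1 (\<lambda>w1. centered_normal Q \<bind> (\<lambda>x0. KW2 (x0, w1)))"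
    (is "is_cond_distr J borel borel W2 W1 ?K")
proof -
  interpret cQ: prob_space "centered_normal Q" by (rule prob_space_centered_normal[OF Q])
  interpret PW1: prob_space PW1 by (rule policy_prob_space)
  interpret P: pair_prob_space "centered_normal Q" PW1 ..
  note [measurable] = policy_measurable(2-4) policy_measurable(2-4)[THEN measurable_prob_algebraD]
  have swap: "(\<lambda>p. KW2 (snd p, fst p)) \<in> borel \<rightarrow>\<^sub>M prob_algebra borel"
    by (intro measurable_compose[OF _ policy_measurable(2)] borel_measurable_continuous_onI continuous_intros)
  have K: "?K \<in> borel \<rightarrow>\<^sub>M prob_algebra borel"
    using measurable_kernel_bind[OF _ swap, of "\<lambda>_. centered_normal Q"] policy_measurable(5) by simp
  have "distr J (borel \<Otimes>\<^sub>M borel) (\<lambda>\<omega>. (W1 \<omega>, W2 \<omega>)) =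
      distr J borel W1 \<bind> (\<lambda>w1. ?K w1 \<bind> (\<lambda>w2. return (borel \<Otimes>\<^sub>M borel) (w1, w2)))" (is "?L = ?R")
  proof (rule measure_eqI)
    have "(\<lambda>w1. ?K w1 \<bind> (\<lambda>w2. return (borel \<Otimes>\<^sub>M borel) (w1, w2))) \<in> borel \<rightarrow>\<^sub>M prob_algebra (borel \<Otimes>\<^sub>M borel)"
      by (rule measurable_bind_prob_space2[OF K]) measurable
    then show sets: "sets ?L = sets ?R"
      using sets_bind'[OF policy_measurable(1)] by (simp add: distr_joint_law_W1)
    fix A assume "A \<in> sets ?L"
    then have A[measurable]: "A \<in> sets (borel \<Otimes>\<^sub>M borel)" by simp
    have m: "(\<lambda>\<omega>. indicator A (W1 \<omega>, W2 \<omega>) :: ennreal) \<in> borel_measurable borel" by measurable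
    have "emeasure ?L A = (\<integral>\<^sup>+\<omega>. indicator A (W1 \<omega>, W2 \<omega>) \<partial>J)"
      by (subst nn_integral_indicator[symmetric], simp, subst nn_integral_distr) auto
    also have "\<dots> = (\<integral>\<^sup>+x0. \<integral>\<^sup>+w1. \<integral>\<^sup>+w2. indicator A (w1, w2) \<partial>KW2 (x0, w1) \<partial>PW1 \<partial>centered_normal Q)"
      by (subst nn_integral_joint_law[OF m]) (simp add: outcome_simps)
    also have "\<dots> = (\<integral>\<^sup>+w1. \<integral>\<^sup>+x0. \<integral>\<^sup>+w2. indicator A (w1, w2) \<partial>KW2 (x0, w1) \<partial>centered_normal Q \<partial>PW1)"
    proof (rule P.Fubini'[symmetric])
      have "(\<lambda>p. \<integral>\<^sup>+w2. indicator A (snd p, w2) \<partial>KW2 (fst p, snd p)) \<in> borel_measurable (borel \<Otimes>\<^sub>M borel)"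
        by (rule nn_integral_measurable_subprob_algebra2[where N = borel]) measurable
      then show "(\<lambda>(x0, w1). \<integral>\<^sup>+w2. indicator A (w1, w2) \<partial>KW2 (x0, w1)) \<in> borel_measurable (centered_normal Q \<Otimes>\<^sub>M PW1)"
        by (simp add: case_prod_unfold cong: measurable_cong_sets sets_pair_measure_cong)
    qed
    also have "\<dots> = (\<integral>\<^sup>+w1. \<integral>\<^sup>+w2. indicator A (w1, w2) \<partial>?K w1 \<partial>PW1)"
      by (rule nn_integral_cong, subst nn_integral_kernel_bind[OF _ swap, simplified]) auto
    also have "\<dots> = (\<integral>\<^sup>+p. indicator A p \<partial>?R)"
      unfolding distr_joint_law_W1 by (rule nn_integral_bind_Pair[OF K, symmetric]) auto
    also have "\<dots> = emeasure ?R A"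
      using sets by (intro nn_integral_indicator) simp
    finally show "emeasure ?L A = emeasure ?R A" .
  qed
  with K show ?thesis by (simp add: is_cond_distr_def)
qed

lemma cond_mutual_info_joint_law:
  "cond_mutual_info b J borel borel borel W2 X0 W1 =
    mutual_info b J (borel \<Otimes>\<^sub>M borel) borel (\<lambda>\<omega>. (W1 \<omega>, W2 \<omega>)) X0"
  by (rule cond_mutual_info_indep[OF prob_space_joint_law _ _ _ joint_law_indep joint_law_cond_distr]) measurable

end

subsection \<open>Lower bound on the cost\<close>

lemma centered_normal_eq_distr:
  assumes "v > 0"
  shows "centered_normal v = distr std_gaussian borel (\<lambda>t. sqrt v * t)"
  using distr_std_gaussian_affine[of "sqrt v" 0] assms by (simp add: centered_normal_def)

lemma nn_integral_centered_normal:
  assumes "v > 0" and [measurable]: "h \<in> borel_measurable borel"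
  shows "(\<integral>\<^sup>+x. h x \<partial>centered_normal v) = (\<integral>\<^sup>+t. h (sqrt v * t) \<partial>std_gaussian)"
  unfolding centered_normal_eq_distr[OF assms(1)]
  by (rule nn_integral_distr) (simp_all cong: measurable_cong_sets)

lemma nn_integral_centered_normal_uminus:
  assumes v: "v > 0" and [measurable]: "h \<in> borel_measurable borel"
  shows "(\<integral>\<^sup>+x. h (- x) \<partial>centered_normal v) = (\<integral>\<^sup>+x. h x \<partial>centered_normal v)"
proof -
  have "orthogonal_transformation (uminus :: real \<Rightarrow> real)"
    by (auto simp: orthogonal_transformation_def intro!: linearI)
  from nn_integral_std_gaussian_isometry[OF this, of "\<lambda>t. h (sqrt v * t)"] show ?thesis
    by (simp add: nn_integral_centered_normal[OF v])
qed

text \<open>The two nonnegative integrals are those of the positive and negative parts, so symmetry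
  can be checked with the iterated formula, which covers nonnegative functions only.\<close>

lemma integral_eq_0_if_antisymmetric:
  fixes f :: "'a \<Rightarrow> real"
  assumes "integrable M f" and "(\<integral>\<^sup>+x. ennreal (f x) \<partial>M) = (\<integral>\<^sup>+x. ennreal (- f x) \<partial>M)"
  shows "(\<integral>x. f x \<partial>M) = 0"
  using assms by (simp add: real_lebesgue_integral_def)

lemma mutual_info_distr:
  assumes [measurable]: "f \<in> M \<rightarrow>\<^sub>M M'" "X \<in> M' \<rightarrow>\<^sub>M S" "Y \<in> M' \<rightarrow>\<^sub>M T"
  shows "mutual_info b (distr M M' f) S T X Y = mutual_info b M S T (\<lambda>z. X (f z)) (\<lambda>z. Y (f z))"
  unfolding mutual_info_def by (simp add: distr_distr comp_def)

text \<open>Orthogonal projection onto the span. The vectors \<open>w1\<close> and \<open>w2\<close>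
  may be dependent or zero, which accommodates degenerate laws.\<close>

lemma orthogonal_decomposition2:
  fixes y w1 w2 :: "'a::euclidean_space"
  obtains c1 c2 r where "y = c1 *\<^sub>R w1 + c2 *\<^sub>R w2 + r" "r \<bullet> w1 = 0" "r \<bullet> w2 = 0"
proof -
  obtain p r where p: "p \<in> span {w1, w2}" and r: "\<And>w. w \<in> span {w1, w2} \<Longrightarrow> orthogonal r w" and y: "y = p + r"
    using orthogonal_subspace_decomp_exists[of "{w1, w2}" y] by metis
  obtain c1 c2 where "p = c1 *\<^sub>R w1 + c2 *\<^sub>R w2"
    using p by (auto simp: span_insert span_singleton) (metis add.commute diff_add_cancel)
  moreover have "r \<bullet> w1 = 0" "r \<bullet> w2 = 0"
    using r[of w1] r[of w2] by (auto simp: orthogonal_def span_base)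
  ultimately show ?thesis using that y by blast
qed

text \<open>A linear functional composed with the affine map is again affine, and the adjoint
  supplies the vector that represents it.\<close>

lemma gaussian_law_obtain:
  fixes J :: "'a::euclidean_space measure"
  assumes "gaussian_law J"
  obtains \<phi> :: "'a \<Rightarrow> 'a" where "\<phi> \<in> borel_measurable borel" "J = distr std_gaussian borel \<phi>"
    "\<And>X. linear X \<Longrightarrow> \<exists>m a. \<forall>z. X (\<phi> z) = (m::real) + a \<bullet> z"
proof -
  obtain m and A :: "'a \<Rightarrow> 'a" where A: "linear A" and J: "J = distr std_gaussian borel (\<lambda>z. m + A z)"
    using assms by (auto simp: gaussian_law_def)
  have [measurable]: "A \<in> borel_measurable borel"
    using A by (intro borel_measurable_continuous_onI linear_continuous_on) (simp add: linear_conv_bounded_linear)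
  have "\<exists>k a. \<forall>z. X (m + A z) = (k::real) + a \<bullet> z" if X: "linear X" for X
  proof -
    have "X (A z) = adjoint (X \<circ> A) 1 \<bullet> z" for z
      using adjoint_works[OF linear_compose[OF A X], of z 1] by (simp add: inner_commute)
    then show ?thesis
      using linear_add[OF X] by (intro exI[of _ "X m"] exI[of _ "adjoint (X \<circ> A) 1"]) simp
  qed
  then show ?thesis using that[of "\<lambda>z. m + A z"] J by simp
qed

section \<open>From conditional independence to orthogonality\<close>

text \<open>Flipping the component along \<open>q\<close> changes the sign of \<open>T\<close> but
  keeps \<open>V\<close>, and \<open>U\<close> is drawn from \<open>V\<close> alone. Hence
  \<open>T * U\<close> has a symmetric law and mean 0, while the moment formula gives mean
  \<open>q \<bullet> u\<close>.\<close>

lemma cond_indep_imp_orthogonal: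
  fixes \<phi> :: "'a::euclidean_space \<Rightarrow> 'a" and V :: "'a \<Rightarrow> 'v::second_countable_topology" and q u :: 'a
  assumes J: "J = distr std_gaussian borel \<phi>"
    and [measurable]: "\<phi> \<in> borel_measurable borel" "V \<in> borel_measurable borel" "T \<in> borel_measurable borel"
      "U \<in> borel_measurable borel"
    and V: "\<And>z s. V (\<phi> (z + s *\<^sub>R q)) = V (\<phi> z)"
    and T: "\<And>z. T (\<phi> z) = q \<bullet> z" and U: "\<And>z. U (\<phi> z) = m + u \<bullet> z"
    and K: "K \<in> borel \<rightarrow>\<^sub>M prob_algebra borel"
    and kernel: "\<And>h. h \<in> borel_measurable borel \<Longrightarrow> (\<integral>\<^sup>+\<omega>. h (V \<omega>, T \<omega>, U \<omega>) \<partial>J) =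
      (\<integral>\<^sup>+\<omega>. \<integral>\<^sup>+x. h (V \<omega>, T \<omega>, x) \<partial>K (V \<omega>) \<partial>J)"
  shows "q \<bullet> u = 0"
proof -
  note [measurable] = K measurable_prob_algebraD[OF K]
  have sym: "(\<integral>\<^sup>+\<omega>. h (T \<omega> * U \<omega>) \<partial>J) = (\<integral>\<^sup>+\<omega>. h (- (T \<omega> * U \<omega>)) \<partial>J)"
    if [measurable]: "h \<in> borel_measurable borel" for h :: "real \<Rightarrow> ennreal"
  proof -
    define G where "G p = (\<integral>\<^sup>+x. h (snd p * x) \<partial>K (fst p))" for p
    have G[measurable]: "G \<in> borel_measurable (borel \<Otimes>\<^sub>M borel)"
      unfolding G_def by (rule nn_integral_measurable_subprob_algebra2[where N = borel]) measurable
    have G': "(\<lambda>\<omega>. G (V \<omega>, c * T \<omega>)) \<in> borel_measurable borel" for c by measurable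
    have "(\<integral>\<^sup>+\<omega>. h (T \<omega> * U \<omega>) \<partial>J) = (\<integral>\<^sup>+\<omega>. G (V \<omega>, T \<omega>) \<partial>J)"
      using kernel[of "\<lambda>(v, t, x). h (t * x)"] by (simp add: G_def case_prod_unfold borel_prod[symmetric])
    also have "\<dots> = (\<integral>\<^sup>+z. G (V (\<phi> z), q \<bullet> z) \<partial>std_gaussian)"
      unfolding J by (subst nn_integral_distr) (auto simp: T)
    also have "\<dots> = (\<integral>\<^sup>+z. G (V (\<phi> z), - (q \<bullet> z)) \<partial>std_gaussian)"
      by (rule nn_integral_std_gaussian_symmetric[where S = borel]) (auto simp: V)
    also have "\<dots> = (\<integral>\<^sup>+\<omega>. G (V \<omega>, - T \<omega>) \<partial>J)"
      unfolding J using G'[of "-1"] by (subst nn_integral_distr) (auto simp: T)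
    also have "\<dots> = (\<integral>\<^sup>+\<omega>. h (- (T \<omega> * U \<omega>)) \<partial>J)"
      using kernel[of "\<lambda>(v, t, x). h (- (t * x))"] by (simp add: G_def case_prod_unfold borel_prod[symmetric])
    finally show ?thesis .
  qed
  have "has_bochner_integral J (\<lambda>\<omega>. T \<omega> * U \<omega>) (q \<bullet> u)"
    unfolding J using std_gaussian_affine_moment[of 0 q m u]
    by (intro has_bochner_integral_distr) (auto simp: T U)
  moreover have "(\<integral>\<omega>. T \<omega> * U \<omega> \<partial>J) = 0"
    using calculation sym[of ennreal] by (intro integral_eq_0_if_antisymmetric) (auto simp: has_bochner_integral_iff)
  ultimately show ?thesis by (simp add: has_bochner_integral_iff)
qed

text \<open>The second-order content of the factorisation of the joint law. The last two clauses
  encode the conditional independences of the encoder and of the decoder, for residuals orthogonal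
  to the conditioning variables.\<close>

lemma (in policy_law) joint_law_orthogonality:
  fixes \<phi> :: "outcome \<Rightarrow> outcome"
  assumes \<phi>[measurable]: "\<phi> \<in> borel_measurable borel"
    and J: "J = distr std_gaussian borel \<phi>"
    and X0: "\<And>z. X0 (\<phi> z) = mx0 + x0 \<bullet> z" and W1: "\<And>z. W1 (\<phi> z) = mw1 + w1 \<bullet> z"
    and W2: "\<And>z. W2 (\<phi> z) = mw2 + w2 \<bullet> z" and U1: "\<And>z. U1 (\<phi> z) = mu1 + u1 \<bullet> z"
    and X1: "\<And>z. X1 (\<phi> z) = mx1 + x1 \<bullet> z" and Y1: "\<And>z. Y1 (\<phi> z) = my1 + y1 \<bullet> z"
    and U2: "\<And>z. U2 (\<phi> z) = mu2 + u2 \<bullet> z"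
  shows "x0 \<bullet> x0 = Q" and "w1 \<bullet> x0 = 0" and "x1 = x0 + u1"
    and "(y1 - x1) \<bullet> (y1 - x1) = N" and "x0 \<bullet> (y1 - x1) = 0" "w1 \<bullet> (y1 - x1) = 0"
      "w2 \<bullet> (y1 - x1) = 0" "u1 \<bullet> (y1 - x1) = 0"
    and "\<And>a b t. t = w2 - a *\<^sub>R x0 - b *\<^sub>R w1 \<Longrightarrow> t \<bullet> x0 = 0 \<Longrightarrow> t \<bullet> w1 = 0 \<Longrightarrow> t \<bullet> u1 = 0"
    and "\<And>a b c d e q. q = a *\<^sub>R x0 + b *\<^sub>R w1 + c *\<^sub>R w2 + d *\<^sub>R u1 + e *\<^sub>R y1 \<Longrightarrow>
      q \<bullet> w1 = 0 \<Longrightarrow> q \<bullet> w2 = 0 \<Longrightarrow> q \<bullet> y1 = 0 \<Longrightarrow> q \<bullet> u2 = 0"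
proof -
  define Jl where "Jl = J"
  note nnJ = nn_integral_joint_law[folded Jl_def]
  have Jl: "Jl = distr std_gaussian borel \<phi>" unfolding Jl_def by (rule J)
  have sets_Jl[measurable_cong]: "sets Jl = sets borel" by (simp add: Jl)
  have moment: "has_bochner_integral Jl (\<lambda>\<omega>. F \<omega> * G \<omega>) (m * k + a \<bullet> b)"
    if "\<And>z. F (\<phi> z) = m + a \<bullet> z" "\<And>z. G (\<phi> z) = k + b \<bullet> z"
      "F \<in> borel_measurable borel" "G \<in> borel_measurable borel" for F G :: "outcome \<Rightarrow> real" and m k a b
    unfolding Jl using std_gaussian_affine_moment[of m a k b] that
    by (intro has_bochner_integral_distr) auto
  \<comment> \<open>The first two moments of a centred normal law determine the constant and the
    norm of the representing vector.\<close>
  have normal_moment: "m = 0 \<and> a \<bullet> a = v"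
    if F: "\<And>z. F (\<phi> z) = m + a \<bullet> z" and [measurable]: "F \<in> borel_measurable borel"
      and v: "v > 0" and law: "distr Jl borel F = centered_normal v" for F :: "outcome \<Rightarrow> real" and m a v
  proof -
    have FJ: "F \<in> Jl \<rightarrow>\<^sub>M borel" using that(2) by (simp add: measurable_cong_sets[OF sets_Jl refl])
    have "has_bochner_integral Jl (\<lambda>\<omega>. F \<omega> * 1) (m * 1 + a \<bullet> 0)"
      by (rule moment[OF F]) simp_all
    then have "(\<integral>x. x \<partial>distr Jl borel F) = m"
      using integral_distr[OF FJ, of "\<lambda>x. x"] by (simp add: has_bochner_integral_iff)
    moreover have "(\<integral>x. x \<partial>centered_normal v) = 0"
      unfolding centered_normal_eq_distr[OF v]
      using std_gaussian_real_moment(1) by (subst integral_distr) (auto simp: has_bochner_integral_iff)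
    moreover have "(\<integral>x. x * x \<partial>distr Jl borel F) = m * m + a \<bullet> a"
    proof -
      have "has_bochner_integral Jl (\<lambda>\<omega>. F \<omega> * F \<omega>) (m * m + a \<bullet> a)"
        by (rule moment[OF F F]) simp_all
      moreover have "(\<lambda>x. x * x) \<in> borel_measurable (borel :: real measure)" by measurable
      ultimately show ?thesis
        using integral_distr[OF FJ, of "\<lambda>x. x * x"] by (simp add: has_bochner_integral_iff)
    qed
    moreover have "(\<integral>x. x * x \<partial>centered_normal v) = (\<integral>t. v * t\<^sup>2 \<partial>std_gaussian)"
      unfolding centered_normal_eq_distr[OF v] using v
      by (subst integral_distr) (auto simp: power2_eq_square ac_simps real_sqrt_mult_self)
    moreover have "(\<integral>t. v * t\<^sup>2 \<partial>std_gaussian) = v"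
      using std_gaussian_real_moment(2) by (simp add: has_bochner_integral_iff)
    ultimately show ?thesis by (simp add: law)
  qed
  have x0: "mx0 = 0 \<and> x0 \<bullet> x0 = Q"
    by (rule normal_moment[OF X0 _ Q]) (auto simp: distr_joint_law_X0[folded Jl_def])
  then show "x0 \<bullet> x0 = Q" by simp
  \<comment> \<open>The mean of the product is computed twice: by the moment formula, and as 0 since
    \<open>X0\<close> is symmetric and independent of \<open>W1\<close>.\<close>
  have "has_bochner_integral Jl (\<lambda>\<omega>. W1 \<omega> * X0 \<omega>) (mw1 * mx0 + w1 \<bullet> x0)"
    by (rule moment[OF W1 X0]) auto
  moreover have "(\<integral>\<omega>. W1 \<omega> * X0 \<omega> \<partial>Jl) = 0"
  proof (rule integral_eq_0_if_antisymmetric)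
    show "integrable Jl (\<lambda>\<omega>. W1 \<omega> * X0 \<omega>)" using calculation by (simp add: has_bochner_integral_iff)
    interpret PW1: prob_space PW1 by (rule policy_prob_space(1))
    have nn: "(\<integral>\<^sup>+\<omega>. ennreal (c * (W1 \<omega> * X0 \<omega>)) \<partial>Jl) =
        (\<integral>\<^sup>+x. \<integral>\<^sup>+w. ennreal (c * (w * x)) \<partial>PW1 \<partial>centered_normal Q)" for c
      by (subst nnJ) (auto simp: outcome_simps policy_space policy_emeasure_UNIV)
    have "(\<integral>\<^sup>+x. \<integral>\<^sup>+w. ennreal (1 * (w * x)) \<partial>PW1 \<partial>centered_normal Q) =
        (\<integral>\<^sup>+x. \<integral>\<^sup>+w. ennreal (1 * (w * - x)) \<partial>PW1 \<partial>centered_normal Q)"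
      by (rule nn_integral_centered_normal_uminus[OF Q, symmetric]) measurable
    then show "(\<integral>\<^sup>+\<omega>. ennreal (W1 \<omega> * X0 \<omega>) \<partial>Jl) = (\<integral>\<^sup>+\<omega>. ennreal (- (W1 \<omega> * X0 \<omega>)) \<partial>Jl)"
      using nn[of 1] nn[of "-1"] by simp
  qed
  ultimately show "w1 \<bullet> x0 = 0" using x0 by (simp add: has_bochner_integral_iff)
  \<comment> \<open>An almost surely zero variable has second moment 0, which here is a sum of two
    squares; so the representing vector vanishes.\<close>
  have "has_bochner_integral Jl (\<lambda>\<omega>. (X1 \<omega> - X0 \<omega> - U1 \<omega>) * (X1 \<omega> - X0 \<omega> - U1 \<omega>))
      ((mx1 - mx0 - mu1) * (mx1 - mx0 - mu1) + (x1 - x0 - u1) \<bullet> (x1 - x0 - u1))"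
    by (rule moment) (auto simp: X0 U1 X1 inner_diff_left)
  moreover have "(\<integral>\<omega>. (X1 \<omega> - X0 \<omega> - U1 \<omega>) * (X1 \<omega> - X0 \<omega> - U1 \<omega>) \<partial>Jl) = 0"
    by (rule integral_eq_zero_AE) (use AE_joint_law_X1[folded Jl_def] in \<open>auto elim!: eventually_mono\<close>)
  ultimately have "(x1 - x0 - u1) \<bullet> (x1 - x0 - u1) = - ((mx1 - mx0 - mu1) * (mx1 - mx0 - mu1))"
    by (simp add: has_bochner_integral_iff)
  then have "(x1 - x0 - u1) \<bullet> (x1 - x0 - u1) = 0"
    using inner_ge_zero[of "x1 - x0 - u1"] by (smt (verit) zero_le_square)
  then have "x1 - x0 - u1 = 0" by (simp only: inner_eq_zero_iff)
  then show x1: "x1 = x0 + u1" by (simp add: diff_diff_eq)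

  have noise: "(\<integral>\<^sup>+\<omega>. h (X0 \<omega>, W1 \<omega>, W2 \<omega>, U1 \<omega>, Y1 \<omega> - X1 \<omega>) \<partial>Jl) =
    (\<integral>\<^sup>+\<omega>. \<integral>\<^sup>+z. h (X0 \<omega>, W1 \<omega>, W2 \<omega>, U1 \<omega>, z) \<partial>centered_normal N \<partial>Jl)"
    if "h \<in> borel_measurable borel" for h
    by (rule nn_integral_joint_law_noise[OF that, folded Jl_def])
  interpret Jp: prob_space Jl unfolding Jl_def by (rule prob_space_joint_law)
  have "distr Jl borel (\<lambda>\<omega>. Y1 \<omega> - X1 \<omega>) = centered_normal N"
  proof (rule measure_eqI)
    fix A assume "A \<in> sets (distr Jl borel (\<lambda>\<omega>. Y1 \<omega> - X1 \<omega>))"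
    then have [measurable]: "A \<in> sets borel" by simp
    have "emeasure (distr Jl borel (\<lambda>\<omega>. Y1 \<omega> - X1 \<omega>)) A = (\<integral>\<^sup>+\<omega>. indicator A (Y1 \<omega> - X1 \<omega>) \<partial>Jl)"
      by (subst nn_integral_indicator[symmetric], simp, subst nn_integral_distr) auto
    also have "\<dots> = (\<integral>\<^sup>+\<omega>. \<integral>\<^sup>+z. indicator A z \<partial>centered_normal N \<partial>Jl)"
      using noise[of "\<lambda>q. indicator A (snd (snd (snd (snd q))))"]
      by (simp add: borel_prod[symmetric])
    also have "\<dots> = emeasure (centered_normal N) A"
      by (simp add: Jp.emeasure_space_1)
    finally show "emeasure (distr Jl borel (\<lambda>\<omega>. Y1 \<omega> - X1 \<omega>)) A = emeasure (centered_normal N) A" .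
  qed simp
  from normal_moment[OF _ _ N this, of "my1 - mx1" "y1 - x1"]
  have n: "my1 - mx1 = 0" and nn: "(y1 - x1) \<bullet> (y1 - x1) = N"
    by (auto simp: X1 Y1 inner_diff_left)
  show "(y1 - x1) \<bullet> (y1 - x1) = N" by (rule nn)
  \<comment> \<open>The noise is symmetric and independent of \<open>F\<close>, so the mean of the
    product is 0; as the noise has no constant term, that mean is the inner product.\<close>
  have orth: "f \<bullet> (y1 - x1) = 0"
    if F: "\<And>z. F (\<phi> z) = m + f \<bullet> z" and Fe: "F = (\<lambda>\<omega>. F' (X0 \<omega>, W1 \<omega>, W2 \<omega>, U1 \<omega>))"
      and F'[measurable]: "F' \<in> borel_measurable borel" for F F' m f
  proof -
    have [measurable]: "F \<in> borel_measurable borel" unfolding Fe by measurable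
    have "has_bochner_integral Jl (\<lambda>\<omega>. F \<omega> * (Y1 \<omega> - X1 \<omega>)) (m * (my1 - mx1) + f \<bullet> (y1 - x1))"
      by (rule moment[OF F]) (auto simp: X1 Y1 inner_diff_left)
    moreover have "(\<integral>\<omega>. F \<omega> * (Y1 \<omega> - X1 \<omega>) \<partial>Jl) = 0"
    proof (rule integral_eq_0_if_antisymmetric)
      show "integrable Jl (\<lambda>\<omega>. F \<omega> * (Y1 \<omega> - X1 \<omega>))" using calculation by (simp add: has_bochner_integral_iff)
      have c: "(\<integral>\<^sup>+\<omega>. ennreal (c * (F \<omega> * (Y1 \<omega> - X1 \<omega>))) \<partial>Jl) =
          (\<integral>\<^sup>+\<omega>. \<integral>\<^sup>+z. ennreal (c * (F \<omega> * z)) \<partial>centered_normal N \<partial>Jl)" for c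
      proof -
        have "(\<lambda>(x, w, w', u, z). ennreal (c * (F' (x, w, w', u) * z))) \<in> borel_measurable borel"
          by (simp add: borel_prod[symmetric])
        from noise[OF this] show ?thesis by (simp add: Fe)
      qed
      have "(\<integral>\<^sup>+z. ennreal (F \<omega> * - z) \<partial>centered_normal N) = (\<integral>\<^sup>+z. ennreal (F \<omega> * z) \<partial>centered_normal N)" for \<omega>
        by (rule nn_integral_centered_normal_uminus[OF N]) measurable
      then show "(\<integral>\<^sup>+\<omega>. ennreal (F \<omega> * (Y1 \<omega> - X1 \<omega>)) \<partial>Jl) = (\<integral>\<^sup>+\<omega>. ennreal (- (F \<omega> * (Y1 \<omega> - X1 \<omega>))) \<partial>Jl)"
        using c[of 1] c[of "-1"] by simp
    qed
    ultimately show ?thesis using n by (simp add: has_bochner_integral_iff)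
  qed
  show "x0 \<bullet> (y1 - x1) = 0"
    by (rule orth[OF X0, of "\<lambda>(x, w, w', u). x"]) (auto simp: borel_prod[symmetric])
  show "w1 \<bullet> (y1 - x1) = 0"
    by (rule orth[OF W1, of "\<lambda>(x, w, w', u). w"]) (auto simp: borel_prod[symmetric])
  show "w2 \<bullet> (y1 - x1) = 0"
    by (rule orth[OF W2, of "\<lambda>(x, w, w', u). w'"]) (auto simp: borel_prod[symmetric])
  show "u1 \<bullet> (y1 - x1) = 0"
    by (rule orth[OF U1, of "\<lambda>(x, w, w', u). u"]) (auto simp: borel_prod[symmetric])

  show "t \<bullet> u1 = 0" if t_def: "t = w2 - a *\<^sub>R x0 - b *\<^sub>R w1" and t: "t \<bullet> x0 = 0" "t \<bullet> w1 = 0" for a b t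
  proof (rule cond_indep_imp_orthogonal[OF Jl \<phi>])
    \<comment> \<open>\<open>?T\<close> is the residual of \<open>W2\<close> after regression on
      \<open>(X0, W1)\<close>, centred so that \<open>t\<close> alone represents it.\<close>
    let ?V = "\<lambda>\<omega>. (X0 \<omega>, W1 \<omega>)" and ?T = "\<lambda>\<omega>. W2 \<omega> - a * X0 \<omega> - b * W1 \<omega> - (mw2 - a * mx0 - b * mw1)"
    show "?V \<in> borel_measurable borel" "?T \<in> borel_measurable borel" "U1 \<in> borel_measurable borel" by measurable
    show "?V (\<phi> (z + s *\<^sub>R t)) = ?V (\<phi> z)" for z s
      using t by (simp add: X0 W1 inner_add_right inner_commute)
    show "?T (\<phi> z) = t \<bullet> z" for z
      by (simp add: X0 W1 W2 t_def inner_diff_left algebra_simps)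
    show "U1 (\<phi> z) = mu1 + u1 \<bullet> z" for z by (rule U1)
    show "KU1 \<in> borel \<rightarrow>\<^sub>M prob_algebra borel" by (rule policy_measurable)
    fix h :: "(real \<times> real) \<times> real \<times> real \<Rightarrow> ennreal" assume [measurable]: "h \<in> borel_measurable borel"
    let ?h = "\<lambda>(x, w, w', u). h ((x, w), w' - a * x - b * w - (mw2 - a * mx0 - b * mw1), u)"
    have "?h \<in> borel_measurable borel"
      by (simp add: case_prod_unfold, intro measurable_compose[OF _ \<open>h \<in> borel_measurable borel\<close>]
        borel_measurable_continuous_onI continuous_intros)
    from nn_integral_joint_law_U1[OF this, folded Jl_def]
    show "(\<integral>\<^sup>+\<omega>. h (?V \<omega>, ?T \<omega>, U1 \<omega>) \<partial>Jl) = (\<integral>\<^sup>+\<omega>. \<integral>\<^sup>+x. h (?V \<omega>, ?T \<omega>, x) \<partial>KU1 (?V \<omega>) \<partial>Jl)"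
      by simp
  qed
  show "q \<bullet> u2 = 0" if q_def: "q = a *\<^sub>R x0 + b *\<^sub>R w1 + c *\<^sub>R w2 + d *\<^sub>R u1 + e *\<^sub>R y1"
    and q: "q \<bullet> w1 = 0" "q \<bullet> w2 = 0" "q \<bullet> y1 = 0" for a b c d e q
  proof (rule cond_indep_imp_orthogonal[OF Jl \<phi>])
    let ?k = "a * mx0 + b * mw1 + c * mw2 + d * mu1 + e * my1"
    let ?V = "\<lambda>\<omega>. (W1 \<omega>, W2 \<omega>, Y1 \<omega>)" and ?T = "\<lambda>\<omega>. a * X0 \<omega> + b * W1 \<omega> + c * W2 \<omega> + d * U1 \<omega> + e * Y1 \<omega> - ?k"
    show "?V \<in> borel_measurable borel" "?T \<in> borel_measurable borel" "U2 \<in> borel_measurable borel" by measurable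
    show "?V (\<phi> (z + s *\<^sub>R q)) = ?V (\<phi> z)" for z s
      using q by (simp add: W1 W2 Y1 inner_add_right inner_commute)
    show "?T (\<phi> z) = q \<bullet> z" for z
      by (simp add: X0 W1 W2 U1 Y1 q_def inner_add_left algebra_simps)
    show "U2 (\<phi> z) = mu2 + u2 \<bullet> z" for z by (rule U2)
    show "KU2 \<in> borel \<rightarrow>\<^sub>M prob_algebra borel" by (rule policy_measurable)
    fix h :: "(real \<times> real \<times> real) \<times> real \<times> real \<Rightarrow> ennreal" assume [measurable]: "h \<in> borel_measurable borel"
    let ?h = "\<lambda>(x, w, w', u, y, u'). h ((w, w', y), a * x + b * w + c * w' + d * u + e * y - ?k, u')"
    have "?h \<in> borel_measurable borel"
      by (simp add: case_prod_unfold, intro measurable_compose[OF _ \<open>h \<in> borel_measurable borel\<close>]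
        borel_measurable_continuous_onI continuous_intros)
    from nn_integral_joint_law_U2[OF this, folded Jl_def]
    show "(\<integral>\<^sup>+\<omega>. h (?V \<omega>, ?T \<omega>, U2 \<omega>) \<partial>Jl) = (\<integral>\<^sup>+\<omega>. \<integral>\<^sup>+x. h (?V \<omega>, ?T \<omega>, x) \<partial>KU2 (?V \<omega>) \<partial>Jl)"
      by simp
  qed
qed

text \<open>The residual variance of \<open>X\<^sub>1\<close> given \<open>(W\<^sub>1,W\<^sub>2)\<close> for \<open>U\<^sub>1 = \<alpha> X\<^sub>0 + W\<^sub>1\<close> with
  \<open>W\<^sub>1\<close> of variance \<open>B\<close>, when the information constraint is tight, and the resulting estimation cost.\<close>

definition residual_var :: "real \<Rightarrow> real \<Rightarrow> real \<Rightarrow> real \<Rightarrow> real" where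
  "residual_var Q N \<alpha> B = (1 + \<alpha>)\<^sup>2 * Q * N / (B + N)"

definition est_cost :: "real \<Rightarrow> real \<Rightarrow> real \<Rightarrow> real \<Rightarrow> real" where
  "est_cost Q N \<alpha> B = residual_var Q N \<alpha> B * N / (residual_var Q N \<alpha> B + N)"

section \<open>Scalar estimation error and the bound for an arbitrary policy\<close>

text \<open>The quantity \<open>s * N / (s + N)\<close> is the least mean square error of estimating
  a Gaussian of variance \<open>s\<close> in independent Gaussian noise of variance
  \<open>N\<close>.\<close>

lemma mmse_mono:
  fixes s t N :: real
  assumes "0 \<le> s" "s \<le> t" "N > 0"
  shows "s * N / (s + N) \<le> t * N / (t + N)"
proof -
  have "s * N * (t + N) \<le> t * N * (s + N)"
    using mult_right_mono[OF assms(2), of "N * N"] assms(3) by (simp add: algebra_simps)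
  then show ?thesis using assms by (simp add: frac_le_eq divide_le_0_iff field_simps)
qed

text \<open>The left side is the error of the linear estimate with gain \<open>s / (s + N)\<close>,
  the optimal one.\<close>

lemma mmse_identity:
  fixes s N :: real
  assumes "s \<ge> 0" "N > 0"
  shows "(1 - s / (s + N))\<^sup>2 * s + (s / (s + N))\<^sup>2 * N = s * N / (s + N)"
proof -
  have *: "1 - s / (s + N) = N / (s + N)" using assms by (simp add: field_simps)
  have "(1 - s / (s + N))\<^sup>2 * s + (s / (s + N))\<^sup>2 * N = (s * N) * (s + N) / (s + N)\<^sup>2"
    unfolding * by (simp add: power_divide add_divide_distrib[symmetric] power2_eq_square algebra_simps)
  then show ?thesis by (simp add: power2_eq_square)
qed

text \<open>Here \<open>\<alpha>\<close> is the regression coefficient of \<open>U1\<close> on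
  \<open>X0\<close>, and \<open>B\<close> collects all other power of \<open>U1\<close>: its squared
  mean, the part carried by \<open>W1\<close> and the private randomness.\<close>

lemma (in policy_law) est_cost_le:
  assumes gauss: "gaussian_law J" and P: "(\<integral>\<omega>. (U1 \<omega>)\<^sup>2 \<partial>J) = P"
    and info: "mutual_info 2 J (borel \<Otimes>\<^sub>M borel) borel (\<lambda>\<omega>. (W1 \<omega>, W2 \<omega>)) Y1
       - cond_mutual_info 2 J borel borel borel W2 X0 W1 \<ge> 0"
  shows "\<exists>\<alpha> B. B \<ge> 0 \<and> \<alpha>\<^sup>2 * Q + B = P \<and> est_cost Q N \<alpha> B \<le> (\<integral>\<omega>. (X1 \<omega> - U2 \<omega>)\<^sup>2 \<partial>J)"
proof -
  obtain \<phi> :: "outcome \<Rightarrow> outcome" where \<phi>[measurable]: "\<phi> \<in> borel_measurable borel"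
    and J: "J = distr std_gaussian borel \<phi>" and lin: "\<And>X. linear X \<Longrightarrow> \<exists>m a. \<forall>z. X (\<phi> z) = (m::real) + a \<bullet> z"
    using gaussian_law_obtain[OF gauss] by metis
  obtain mx0 x0 where X0: "\<And>z. X0 (\<phi> z) = mx0 + x0 \<bullet> z" using lin[OF outcome_linear(1)] by blast
  obtain mw1 w1 where W1: "\<And>z. W1 (\<phi> z) = mw1 + w1 \<bullet> z" using lin[OF outcome_linear(2)] by blast
  obtain mw2 w2 where W2: "\<And>z. W2 (\<phi> z) = mw2 + w2 \<bullet> z" using lin[OF outcome_linear(3)] by blast
  obtain mu1 u1 where U1: "\<And>z. U1 (\<phi> z) = mu1 + u1 \<bullet> z" using lin[OF outcome_linear(4)] by blast
  obtain mx1 x1 where X1: "\<And>z. X1 (\<phi> z) = mx1 + x1 \<bullet> z" using lin[OF outcome_linear(5)] by blast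
  obtain my1 y1 where Y1: "\<And>z. Y1 (\<phi> z) = my1 + y1 \<bullet> z" using lin[OF outcome_linear(6)] by blast
  obtain mu2 u2 where U2: "\<And>z. U2 (\<phi> z) = mu2 + u2 \<bullet> z" using lin[OF outcome_linear(7)] by blast
  note orth = joint_law_orthogonality[OF \<phi> J X0 W1 W2 U1 X1 Y1 U2]
  define n where "n = y1 - x1"
  have nn: "n \<bullet> n = N" "n \<bullet> x0 = 0" "n \<bullet> w1 = 0" "n \<bullet> w2 = 0" "n \<bullet> u1 = 0"
    using orth(4-8) by (simp_all add: n_def inner_commute)
  have x0: "x0 \<bullet> x0 = Q" "x0 \<bullet> w1 = 0" using orth(1,2) by (simp_all add: inner_commute)
  have x1: "x1 = x0 + u1" by (rule orth(3))
  have y1: "y1 = x0 + u1 + n" by (simp add: n_def x1)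
  obtain \<alpha> \<beta> v where u1: "u1 = \<alpha> *\<^sub>R x0 + \<beta> *\<^sub>R w1 + v" and v: "v \<bullet> x0 = 0" "v \<bullet> w1 = 0"
    using orthogonal_decomposition2[of u1 x0 w1] by blast
  obtain c1 c2 d where x0d: "x0 = c1 *\<^sub>R w1 + c2 *\<^sub>R w2 + d" and d: "d \<bullet> w1 = 0" "d \<bullet> w2 = 0"
    using orthogonal_decomposition2[of x0 w1 w2] by blast
  obtain a b t where w2: "w2 = a *\<^sub>R x0 + b *\<^sub>R w1 + t" and t: "t \<bullet> x0 = 0" "t \<bullet> w1 = 0"
    using orthogonal_decomposition2[of w2 x0 w1] by blast
  \<comment> \<open>This is where the conditional independence of \<open>W2\<close> and
    \<open>U1\<close> enters; it makes \<open>W2\<close> orthogonal to the private randomness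
    \<open>v\<close>.\<close>
  have "t \<bullet> u1 = 0"
    by (rule orth(9)[of t a b]) (use w2 t in \<open>auto simp: algebra_simps\<close>)
  then have "t \<bullet> v = 0" using t by (simp add: u1 inner_add_right)
  then have vw2: "v \<bullet> w2 = 0" using v by (simp add: w2 inner_add_right inner_commute)
  have d_eq: "d = x0 - c1 *\<^sub>R w1 - c2 *\<^sub>R w2" by (subst x0d) simp
  have vd: "v \<bullet> d = 0" using v vw2 by (simp add: d_eq inner_diff_right)
  have nd: "n \<bullet> d = 0" using nn by (simp add: d_eq inner_diff_right)
  have v_eq: "v = u1 - \<alpha> *\<^sub>R x0 - \<beta> *\<^sub>R w1" by (simp add: u1)
  have nv: "n \<bullet> v = 0" using nn by (simp add: v_eq inner_diff_right)
  \<comment> \<open>\<open>\<gamma>\<close> is the gain from \<open>X0\<close> to \<open>X1\<close>,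
    \<open>D\<close> the residual variance of \<open>X0\<close> given \<open>(W1, W2)\<close>, and
    \<open>s\<close> that of \<open>X1\<close>, with residual vector \<open>e\<close>.\<close>
  define \<gamma> where "\<gamma> = 1 + \<alpha>"
  define D V where "D = d \<bullet> d" and "V = v \<bullet> v"
  define e where "e = \<gamma> *\<^sub>R d + v"
  define s where "s = \<gamma>\<^sup>2 * D + V"
  have D0: "D \<ge> 0" and V0: "V \<ge> 0" by (simp_all add: D_def V_def)
  have s0: "s \<ge> 0" using D0 V0 by (simp add: s_def)
  have y1_eq: "y1 = (\<gamma> * c1 + \<beta>) *\<^sub>R w1 + (\<gamma> * c2) *\<^sub>R w2 + (e + n)"
    by (simp add: y1 u1 e_def d_eq \<gamma>_def algebra_simps)
  have ee: "e \<bullet> e = s" "n \<bullet> e = 0" "e \<bullet> w1 = 0" "e \<bullet> w2 = 0"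
    using vd nd nv v d vw2
    by (auto simp: e_def s_def D_def V_def inner_add_left inner_add_right inner_commute power2_eq_square)
  have r: "(e + n) \<bullet> (e + n) = s + N" "(e + n) \<bullet> w1 = 0" "(e + n) \<bullet> w2 = 0"
    using ee nn by (simp_all add: inner_add_left inner_add_right inner_commute)
  have r0: "e + n \<noteq> 0" using r(1) s0 N by auto
  have y1_norm: "y1 \<bullet> y1 = \<gamma>\<^sup>2 * Q + \<beta>\<^sup>2 * (w1 \<bullet> w1) + V + N"
  proof -
    have "y1 = \<gamma> *\<^sub>R x0 + \<beta> *\<^sub>R w1 + v + n" by (simp add: y1 u1 \<gamma>_def algebra_simps)
    then show ?thesis
      using x0 v nn nv
      by (simp add: V_def inner_add_left inner_add_right inner_commute power2_eq_square)
  qed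
  have "\<gamma>\<^sup>2 * Q \<ge> 0" "\<beta>\<^sup>2 * (w1 \<bullet> w1) \<ge> 0" using Q by simp_all
  then have "y1 \<bullet> y1 > 0" using y1_norm N V0 by linarith
  then have y10: "y1 \<noteq> 0" by auto
  have x00: "x0 \<noteq> 0" using x0 Q by auto
  have MI: "mutual_info 2 J (borel \<Otimes>\<^sub>M borel) borel (\<lambda>\<omega>. (W1 \<omega>, W2 \<omega>)) F =
      mutual_info 2 std_gaussian (borel \<Otimes>\<^sub>M borel) borel (\<lambda>z. (mw1 + w1 \<bullet> z, mw2 + w2 \<bullet> z)) (\<lambda>z. F (\<phi> z))"
    if [measurable]: "F \<in> borel_measurable borel" for F :: "outcome \<Rightarrow> real"
    unfolding J by (subst mutual_info_distr) (auto simp: W1 W2)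
  have MI_Y: "mutual_info 2 J (borel \<Otimes>\<^sub>M borel) borel (\<lambda>\<omega>. (W1 \<omega>, W2 \<omega>)) Y1 = ereal (log 2 (norm y1 / norm (e + n)))"
    by (subst MI, simp, unfold Y1, rule mutual_info_gaussian_finite[OF y1_eq r(2,3) y10 r0]) simp
  have MI_X: "mutual_info 2 J (borel \<Otimes>\<^sub>M borel) borel (\<lambda>\<omega>. (W1 \<omega>, W2 \<omega>)) X0 =
      mutual_info 2 std_gaussian (borel \<Otimes>\<^sub>M borel) borel (\<lambda>z. (mw1 + w1 \<bullet> z, mw2 + w2 \<bullet> z)) (\<lambda>z. mx0 + x0 \<bullet> z)"
    by (subst MI, simp, unfold X0) simp
  \<comment> \<open>If \<open>(W1, W2)\<close> determined \<open>X0\<close>, the subtracted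
    information would be infinite while that about \<open>Y1\<close> is finite, violating the
    constraint.\<close>
  have d0: "d \<noteq> 0"
  proof
    assume "d = 0"
    then have "mutual_info 2 J (borel \<Otimes>\<^sub>M borel) borel (\<lambda>\<omega>. (W1 \<omega>, W2 \<omega>)) X0 = \<infinity>"
      unfolding MI_X by (rule mutual_info_gaussian_infinite[OF x0d d x00])
    then show False using info by (simp add: cond_mutual_info_joint_law MI_Y)
  qed
  have "mutual_info 2 J (borel \<Otimes>\<^sub>M borel) borel (\<lambda>\<omega>. (W1 \<omega>, W2 \<omega>)) X0 = ereal (log 2 (norm x0 / norm d))"
    unfolding MI_X by (rule mutual_info_gaussian_finite[OF x0d d x00 d0]) simp
  then have "log 2 (norm x0 / norm d) \<le> log 2 (norm y1 / norm (e + n))"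
    using info by (simp add: cond_mutual_info_joint_law MI_Y)
  then have "norm x0 / norm d \<le> norm y1 / norm (e + n)"
    using x00 d0 y10 r0 by (subst (asm) log_le_cancel_iff) auto
  then have "norm x0 * norm (e + n) \<le> norm y1 * norm d"
    using d0 r0 by (simp add: field_simps)
  then have "(norm x0 * norm (e + n))\<^sup>2 \<le> (norm y1 * norm d)\<^sup>2"
    by (intro power_mono) auto
  then have "Q * (s + N) \<le> (\<gamma>\<^sup>2 * Q + \<beta>\<^sup>2 * (w1 \<bullet> w1) + V + N) * D"
    by (simp only: power_mult_distrib power2_norm_eq_inner x0 r(1) y1_norm D_def)
  \<comment> \<open>The terms in \<open>\<gamma>\<^sup>2 * Q * D\<close> cancel, so the constraint
    on \<open>D\<close> no longer involves \<open>\<alpha>\<close>.\<close>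
  then have key: "Q * (V + N) \<le> (\<beta>\<^sup>2 * (w1 \<bullet> w1) + V + N) * D"
    by (simp add: s_def algebra_simps)

  have moment: "(\<integral>\<omega>. (F \<omega>)\<^sup>2 \<partial>J) = m\<^sup>2 + f \<bullet> f"
    if F: "\<And>z. F (\<phi> z) = m + f \<bullet> z" and [measurable]: "F \<in> borel_measurable borel" for F :: "outcome \<Rightarrow> real" and m f
    using std_gaussian_affine_moment[of m f m f] unfolding J
    by (subst integral_distr) (auto simp: F has_bochner_integral_iff power2_eq_square)
  define B where "B = mu1\<^sup>2 + \<beta>\<^sup>2 * (w1 \<bullet> w1) + V"
  have B0: "B \<ge> 0" using V0 by (simp add: B_def)
  have "P = mu1\<^sup>2 + u1 \<bullet> u1" using P moment[OF U1] by simp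
  also have "u1 \<bullet> u1 = \<alpha>\<^sup>2 * Q + \<beta>\<^sup>2 * (w1 \<bullet> w1) + V"
    using x0 v by (simp add: u1 V_def inner_add_left inner_add_right inner_commute power2_eq_square)
  finally have P_eq: "\<alpha>\<^sup>2 * Q + B = P" by (simp add: B_def)

  \<comment> \<open>Discarding \<open>Q * V\<close> on the left and adding the squared mean on the
    right leaves a bound in terms of \<open>B\<close> alone.\<close>
  have "Q * N \<le> Q * (V + N)" using Q V0 by simp
  also have "\<dots> \<le> (\<beta>\<^sup>2 * (w1 \<bullet> w1) + V + N) * D" by (rule key)
  also have "\<dots> \<le> (B + N) * D" using D0 by (intro mult_right_mono) (simp_all add: B_def)
  finally have "Q * N / (B + N) \<le> D" using B0 N by (simp add: field_simps)
  then have "\<gamma>\<^sup>2 * (Q * N / (B + N)) \<le> \<gamma>\<^sup>2 * D" by (intro mult_left_mono) auto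
  then have res: "residual_var Q N \<alpha> B \<le> s" using V0 by (simp add: residual_var_def s_def \<gamma>_def mult.assoc)
  have res0: "residual_var Q N \<alpha> B \<ge> 0" using B0 Q N by (simp add: residual_var_def)

  define g where "g = s / (s + N)"
  \<comment> \<open>The vector \<open>e - g *\<^sub>R (e + n)\<close>: the error of the best linear
    estimate of \<open>X1\<close> from \<open>(W1, W2, Y1)\<close>.\<close>
  define q where "q = (1 - g) *\<^sub>R e - g *\<^sub>R n"
  have g: "g * (s + N) = s" using s0 N by (simp add: g_def)
  have qw: "q \<bullet> w1 = 0" "q \<bullet> w2 = 0" using ee nn by (simp_all add: q_def inner_diff_left)
  have qen: "q \<bullet> (e + n) = 0"
    using ee nn g by (simp add: q_def inner_diff_left inner_add_right inner_commute algebra_simps)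
  then have qy: "q \<bullet> y1 = 0" using qw by (simp add: y1_eq inner_add_right)
  \<comment> \<open>The noise is rewritten as \<open>y1 - x0 - u1\<close> to give the combination
    required by the decoder clause; both coefficients \<open>(1 - g) + g\<close> are 1.\<close>
  have q_eq: "q = ((1 - g) + g) *\<^sub>R x0 + (- (1 - g) * (\<gamma> * c1 + \<beta>)) *\<^sub>R w1 + (- (1 - g) * (\<gamma> * c2)) *\<^sub>R w2
      + ((1 - g) + g) *\<^sub>R u1 + (- g) *\<^sub>R y1"
    by (simp add: q_def e_def d_eq u1 y1 \<gamma>_def algebra_simps)
  have qu2: "q \<bullet> u2 = 0" by (rule orth(10)[OF q_eq qw qy])
  have x1_eq: "x1 = (\<gamma> * c1 + \<beta>) *\<^sub>R w1 + (\<gamma> * c2) *\<^sub>R w2 + g *\<^sub>R (e + n) + q"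
    by (simp add: x1 u1 q_def e_def d_eq \<gamma>_def algebra_simps)
  have "q \<bullet> x1 = q \<bullet> q"
    using qw qen by (simp add: x1_eq inner_add_right)
  \<comment> \<open>Since \<open>q \<bullet> u2 = 0\<close> and
    \<open>q \<bullet> x1 = q \<bullet> q\<close>, the vector \<open>x1 - u2 - q\<close> is
    orthogonal to \<open>q\<close>: no decoder beats the error \<open>q\<close>.\<close>
  then have pyth: "(x1 - u2) \<bullet> (x1 - u2) = (x1 - u2 - q) \<bullet> (x1 - u2 - q) + q \<bullet> q"
    using qu2 by (simp add: inner_diff_left inner_diff_right inner_commute)
  have qq: "q \<bullet> q = s * N / (s + N)"
  proof -
    have "q \<bullet> q = (1 - g)\<^sup>2 * s + g\<^sup>2 * N"
      using ee nn by (simp add: q_def inner_diff_left inner_diff_right inner_commute power2_eq_square)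
    also have "\<dots> = s * N / (s + N)" unfolding g_def by (rule mmse_identity[OF s0 N])
    finally show ?thesis .
  qed
  have "est_cost Q N \<alpha> B \<le> s * N / (s + N)"
    unfolding est_cost_def by (rule mmse_mono[OF res0 res N])
  also have "\<dots> \<le> (x1 - u2) \<bullet> (x1 - u2)" unfolding pyth qq by simp
  also have "\<dots> \<le> (mx1 - mu2)\<^sup>2 + (x1 - u2) \<bullet> (x1 - u2)" by simp
  also have "\<dots> = (\<integral>\<omega>. (X1 \<omega> - U2 \<omega>)\<^sup>2 \<partial>J)"
    by (rule moment[symmetric]) (auto simp: X1 U2 inner_diff_left)
  finally show ?thesis using B0 P_eq by blast
qed

subsection \<open>Attaining the lower bound\<close>

lemma std_gaussian_in_prob_algebra: "std_gaussian \<in> space (prob_algebra borel)"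
  by (simp add: space_prob_algebra prob_space_std_gaussian)

text \<open>The scheme \<open>U\<^sub>1 = \<alpha> X\<^sub>0 + W\<^sub>1\<close>, \<open>W\<^sub>2 = a X\<^sub>0 + T\<close>, \<open>U\<^sub>2 = (1 - g) (W\<^sub>1 + \<kappa> W\<^sub>2) + g Y\<^sub>1\<close>, with
  \<open>T\<close> standard normal.\<close>

definition linear_policy :: "real \<Rightarrow> real \<Rightarrow> real \<Rightarrow> real \<Rightarrow> real \<Rightarrow> policy" where
  "linear_policy \<alpha> B a g \<kappa> =
    (distr std_gaussian borel (\<lambda>t. sqrt B * t),
     \<lambda>p. distr std_gaussian borel (\<lambda>t. a * fst p + t),
     \<lambda>p. return borel (\<alpha> * fst p + snd p),
     \<lambda>q. return borel ((1 - g) * (fst q + \<kappa> * fst (snd q)) + g * snd (snd q)))"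

lemma linear_policy_in_policies: "linear_policy \<alpha> B a g \<kappa> \<in> policies"
proof -
  have 1: "distr std_gaussian borel (\<lambda>t. sqrt B * t) \<in> space (prob_algebra borel)"
    by (auto simp: space_prob_algebra intro!: std_gaussian.prob_space_distr)
  have 2: "(\<lambda>p::real \<times> real. distr std_gaussian borel (\<lambda>t. a * fst p + t)) \<in> borel \<rightarrow>\<^sub>M prob_algebra borel"
    by (rule measurable_distr_prob_space2[where M = borel])
      (auto simp: std_gaussian_in_prob_algebra borel_prod case_prod_unfold
        intro!: borel_measurable_continuous_onI continuous_intros)
  have 3: "(\<lambda>p. return borel (\<alpha> * fst p + snd p)) \<in> borel \<rightarrow>\<^sub>M prob_algebra borel"
    by (intro measurable_compose[OF _ measurable_return_prob_space] borel_measurable_continuous_onI continuous_intros)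
  have 4: "(\<lambda>q. return borel ((1 - g) * (fst q + \<kappa> * fst (snd q)) + g * snd (snd q))) \<in> borel \<rightarrow>\<^sub>M prob_algebra borel"
    by (intro measurable_compose[OF _ measurable_return_prob_space] borel_measurable_continuous_onI continuous_intros)
  show ?thesis unfolding linear_policy_def policies_def using 1 2 3 4 by simp
qed

text \<open>The source has the type \<open>outcome\<close> because \<open>gaussian_law\<close> asks
  for a square map; only four of its seven coordinates are read.\<close>

definition linear_outcome :: "real \<Rightarrow> real \<Rightarrow> real \<Rightarrow> real \<Rightarrow> real \<Rightarrow> real \<Rightarrow> real \<Rightarrow> outcome \<Rightarrow> outcome" where
  "linear_outcome Q N \<alpha> B a g \<kappa> = (\<lambda>(t0, t1, t2, t3, _).
    (let x0 = sqrt Q * t0; w1 = sqrt B * t1; w2 = a * x0 + t2; u1 = \<alpha> * x0 + w1; x1 = x0 + u1; y1 = x1 + sqrt N * t3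
     in (x0, w1, w2, u1, x1, y1, (1 - g) * (w1 + \<kappa> * w2) + g * y1)))"

lemma linear_linear_outcome: "linear (linear_outcome Q N \<alpha> B a g \<kappa>)"
  by (rule linearI) (auto simp: linear_outcome_def Let_def algebra_simps)

lemma joint_law_linear_policy:
  assumes "Q > 0" "N > 0"
  shows "joint_law Q N (linear_policy \<alpha> B a g \<kappa>) = distr std_gaussian borel (linear_outcome Q N \<alpha> B a g \<kappa>)"
    (is "?J = distr _ _ ?\<phi>")
proof -
  interpret policy_law Q N "distr std_gaussian borel (\<lambda>t. sqrt B * t)" "\<lambda>p. distr std_gaussian borel (\<lambda>t. a * fst p + t)"
    "\<lambda>p. return borel (\<alpha> * fst p + snd p)" "\<lambda>q. return borel ((1 - g) * (fst q + \<kappa> * fst (snd q)) + g * snd (snd q))"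
    by unfold_locales (use assms linear_policy_in_policies in \<open>auto simp: linear_policy_def\<close>)
  interpret cN: prob_space "centered_normal N" by (rule prob_space_centered_normal[OF N])
  have \<phi>[measurable]: "?\<phi> \<in> borel_measurable borel"
    using linear_linear_outcome
    by (intro borel_measurable_continuous_onI linear_continuous_on) (simp add: linear_conv_bounded_linear)
  show ?thesis
  proof (rule measure_eqI)
    show "sets ?J = sets (distr std_gaussian borel ?\<phi>)" using sets_joint_law by (simp add: linear_policy_def)
    fix A assume "A \<in> sets ?J"
    then have A[measurable]: "A \<in> sets borel" using sets_joint_law by (simp add: linear_policy_def)
    define f :: "outcome \<Rightarrow> ennreal" where "f = indicator A"
    have f[measurable]: "f \<in> borel_measurable borel" by (simp add: f_def)
    have "emeasure ?J A = (\<integral>\<^sup>+\<omega>. f \<omega> \<partial>?J)"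
      using A sets_joint_law by (simp add: f_def linear_policy_def)
    also have "\<dots> = (\<integral>\<^sup>+x0. \<integral>\<^sup>+t1. \<integral>\<^sup>+t2. \<integral>\<^sup>+z. f (x0, sqrt B * t1, a * x0 + t2, \<alpha> * x0 + sqrt B * t1,
        x0 + (\<alpha> * x0 + sqrt B * t1), x0 + (\<alpha> * x0 + sqrt B * t1) + z,
        (1 - g) * (sqrt B * t1 + \<kappa> * (a * x0 + t2)) + g * (x0 + (\<alpha> * x0 + sqrt B * t1) + z))
      \<partial>centered_normal N \<partial>std_gaussian \<partial>std_gaussian \<partial>centered_normal Q)"
    proof -
      have m: "(\<lambda>u1. \<integral>\<^sup>+z. f (x0, w1, w2, u1, x0 + u1, x0 + u1 + z, (1 - g) * (w1 + \<kappa> * w2) + g * (x0 + u1 + z))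
          \<partial>centered_normal N) \<in> borel_measurable borel"
        "(\<lambda>w2. \<integral>\<^sup>+z. f (x0, w1, w2, u1, x0 + u1, x0 + u1 + z, (1 - g) * (w1 + \<kappa> * w2) + g * (x0 + u1 + z))
          \<partial>centered_normal N) \<in> borel_measurable borel"
        "(\<lambda>w1. \<integral>\<^sup>+t2. \<integral>\<^sup>+z. f (x0, w1, a * x0 + t2, \<alpha> * x0 + w1, x0 + (\<alpha> * x0 + w1), x0 + (\<alpha> * x0 + w1) + z,
            (1 - g) * (w1 + \<kappa> * (a * x0 + t2)) + g * (x0 + (\<alpha> * x0 + w1) + z))
          \<partial>centered_normal N \<partial>std_gaussian) \<in> borel_measurable borel" for x0 w1 w2 u1
        by measurable
      have l: "(\<lambda>t. c * t) \<in> std_gaussian \<rightarrow>\<^sub>M borel" "(\<lambda>t. c + t) \<in> std_gaussian \<rightarrow>\<^sub>M borel" for c :: real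
        by (simp_all cong: measurable_cong_sets)
      show ?thesis
        unfolding linear_policy_def nn_integral_joint_law[OF f]
        by (simp add: nn_integral_distr[OF l(1)] nn_integral_distr[OF l(2)] nn_integral_return m)
    qed
    \<comment> \<open>The three unread coordinates are set to 0; they are integrated out
      afterwards.\<close>
    also have "\<dots> = (\<integral>\<^sup>+t0. \<integral>\<^sup>+t1. \<integral>\<^sup>+t2. \<integral>\<^sup>+t3. f (?\<phi> (t0, t1, t2, t3, 0)) \<partial>std_gaussian \<partial>std_gaussian \<partial>std_gaussian \<partial>std_gaussian)"
      using assms by (simp add: nn_integral_centered_normal linear_outcome_def Let_def)
    also have "\<dots> = (\<integral>\<^sup>+z. f (?\<phi> z) \<partial>std_gaussian)"
    proof -
      have [measurable]: "(\<lambda>r. f (?\<phi> (t0, r))) \<in> borel_measurable borel" "(\<lambda>r. f (?\<phi> (t0, t1, r))) \<in> borel_measurable borel"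
         "(\<lambda>r. f (?\<phi> (t0, t1, t2, r))) \<in> borel_measurable borel" "(\<lambda>r. f (?\<phi> (t0, t1, t2, t3, r))) \<in> borel_measurable borel"
        for t0 t1 t2 t3 by measurable
      show ?thesis
        by (simp add: nn_integral_std_gaussian_prod) (simp add: linear_outcome_def)
    qed
    also have "\<dots> = (\<integral>\<^sup>+\<omega>. f \<omega> \<partial>distr std_gaussian borel ?\<phi>)"
      by (subst nn_integral_distr) auto
    also have "\<dots> = emeasure (distr std_gaussian borel ?\<phi>) A"
      by (simp add: f_def)
    finally show "emeasure ?J A = emeasure (distr std_gaussian borel ?\<phi>) A" .
  qed
qed

lemma est_cost_attained:
  assumes Q: "Q > 0" and N: "N > 0" and B: "B \<ge> 0"
  shows "\<exists>p\<in>gaussian_policies Q N (\<alpha>\<^sup>2 * Q + B). (\<integral>\<omega>. (X1 \<omega> - U2 \<omega>)\<^sup>2 \<partial>joint_law Q N p) = est_cost Q N \<alpha> B"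
proof -
  \<comment> \<open>This value of \<open>a\<close> makes the information constraint tight.\<close>
  define a where "a = sqrt (B / (N * Q))"
  \<comment> \<open>The regression coefficient of \<open>X0\<close> on \<open>W2\<close>: covariance
    \<open>a * Q\<close> over variance \<open>a\<^sup>2 * Q + 1\<close>.\<close>
  define k where "k = a * Q / (a\<^sup>2 * Q + 1)"
  define s where "s = residual_var Q N \<alpha> B"
  define g where "g = s / (s + N)"
  define D where "D = Q * N / (B + N)"
  \<comment> \<open>With this last parameter, \<open>W1 + \<kappa> W2\<close> is the regression of
    \<open>X1\<close> on \<open>(W1, W2)\<close>, and the decoder adds \<open>g\<close> times the
    innovation in \<open>Y1\<close>.\<close>
  define p where "p = linear_policy \<alpha> B a g ((1 + \<alpha>) * k)"
  define \<phi> where "\<phi> = linear_outcome Q N \<alpha> B a g ((1 + \<alpha>) * k)"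
  have a2: "a\<^sup>2 * Q = B / N" using Q N B by (simp add: a_def)
  have s: "s = (1 + \<alpha>)\<^sup>2 * D" by (simp add: s_def residual_var_def D_def)
  have s0: "s \<ge> 0" using Q N B by (simp add: s D_def)
  have D0: "D > 0" using Q N B by (simp add: D_def)
  have ka: "1 - k * a = N / (B + N)" and kk: "k\<^sup>2 = (B / N) * Q / (B / N + 1)\<^sup>2"
  proof -
    have "k * a = a\<^sup>2 * Q / (a\<^sup>2 * Q + 1)" by (simp add: k_def power2_eq_square)
    also have "\<dots> = B / (B + N)" unfolding a2 using N B by (simp add: field_simps)
    finally show "1 - k * a = N / (B + N)" using N B by (simp add: field_simps)
    have "k\<^sup>2 = (a\<^sup>2 * Q) * Q / (a\<^sup>2 * Q + 1)\<^sup>2" by (simp add: k_def power_divide power2_eq_square)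
    then show "k\<^sup>2 = (B / N) * Q / (B / N + 1)\<^sup>2" unfolding a2 .
  qed
  \<comment> \<open>The left side is the variance of \<open>X0 - k * W2\<close>, so \<open>D\<close>
    is the residual variance of \<open>X0\<close> given \<open>(W1, W2)\<close>.\<close>
  have D_eq: "Q * (1 - k * a)\<^sup>2 + k\<^sup>2 = D"
  proof -
    have "(B / N) * Q / (B / N + 1)\<^sup>2 = B * N * Q / (B + N)\<^sup>2"
      using N B by (simp add: power2_eq_square field_simps)
    then have "Q * (1 - k * a)\<^sup>2 + k\<^sup>2 = (Q * N) * (B + N) / (B + N)\<^sup>2"
      unfolding ka kk by (simp add: power_divide add_divide_distrib[symmetric] power2_eq_square algebra_simps)
    then show ?thesis by (simp add: D_def power2_eq_square)
  qed
  have J: "joint_law Q N p = distr std_gaussian borel \<phi>"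
    unfolding p_def \<phi>_def by (rule joint_law_linear_policy[OF Q N])
  have \<phi>[measurable]: "\<phi> \<in> borel_measurable borel"
    unfolding \<phi>_def using linear_linear_outcome
    by (intro borel_measurable_continuous_onI linear_continuous_on) (simp add: linear_conv_bounded_linear)
  have gauss: "gaussian_law (joint_law Q N p)"
    unfolding gaussian_law_def J using linear_linear_outcome
    by (intro exI[of _ 0] exI[of _ \<phi>]) (simp add: \<phi>_def)

  \<comment> \<open>Coordinates with respect to the independent sources of \<open>X0\<close>,
    \<open>W1\<close>, the observation noise in \<open>W2\<close> and the channel noise; a final
    \<open>0\<close> fills all remaining slots.\<close>
  define x0 w1 w2 d n y1 :: outcome where "x0 = (sqrt Q, 0)" and "w1 = (0, sqrt B, 0)"
    and "w2 = (a * sqrt Q, 0, 1, 0)" and "d = (sqrt Q * (1 - k * a), 0, - k, 0)"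
    and "n = (0, 0, 0, sqrt N, 0)" and "y1 = ((1 + \<alpha>) * sqrt Q, sqrt B, 0, sqrt N, 0)"
  note vec = x0_def w1_def w2_def d_def n_def y1_def
  have X0: "X0 (\<phi> z) = 0 + x0 \<bullet> z" and W1: "W1 (\<phi> z) = 0 + w1 \<bullet> z" and W2: "W2 (\<phi> z) = 0 + w2 \<bullet> z"
    and U1: "U1 (\<phi> z) = 0 + (\<alpha> *\<^sub>R x0 + w1) \<bullet> z" and Y1: "Y1 (\<phi> z) = 0 + y1 \<bullet> z"
    and err: "X1 (\<phi> z) - U2 (\<phi> z) = 0 + (((1 - g) * (1 + \<alpha>)) *\<^sub>R d - g *\<^sub>R n) \<bullet> z" for z
    by (cases z, simp add: \<phi>_def linear_outcome_def Let_def outcome_simps vec zero_prod_def algebra_simps)+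
  have x0d: "x0 = 0 *\<^sub>R w1 + k *\<^sub>R w2 + d" by (simp add: vec algebra_simps zero_prod_def)
  have y1d: "y1 = 1 *\<^sub>R w1 + ((1 + \<alpha>) * k) *\<^sub>R w2 + ((1 + \<alpha>) *\<^sub>R d + n)"
    by (simp add: vec algebra_simps zero_prod_def)
  have x0_norm: "x0 \<bullet> x0 = Q" using Q by (simp add: vec)
  have d_norm: "d \<bullet> d = D"
    using Q by (simp add: vec D_eq[symmetric] power2_eq_square mult_ac)
  have "a * Q * (1 - k * a) = k"
    unfolding ka unfolding k_def a2 using N B by (simp add: field_simps)
  moreover have "d \<bullet> w2 = a * (sqrt Q * sqrt Q) * (1 - k * a) - k"
  proof -
    have "d \<bullet> w2 = sqrt Q * (1 - k * a) * (a * sqrt Q) - k" by (simp add: vec)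
    then show ?thesis by (simp only: mult_ac)
  qed
  ultimately have dw: "d \<bullet> w1 = 0" "d \<bullet> w2 = 0"
    using Q by (simp_all add: d_def w1_def)
  have nv: "n \<bullet> n = N" "n \<bullet> w1 = 0" "n \<bullet> w2 = 0" "n \<bullet> d = 0" "d \<bullet> n = 0" using N by (simp_all add: vec)
  have r_norm: "((1 + \<alpha>) *\<^sub>R d + n) \<bullet> ((1 + \<alpha>) *\<^sub>R d + n) = s + N"
    using nv d_norm by (simp add: s inner_add_left inner_add_right power2_eq_square)
  have rw: "((1 + \<alpha>) *\<^sub>R d + n) \<bullet> w1 = 0" "((1 + \<alpha>) *\<^sub>R d + n) \<bullet> w2 = 0"
    using nv dw by (simp_all add: inner_add_left)
  have y1_norm: "y1 \<bullet> y1 = (1 + \<alpha>)\<^sup>2 * Q + B + N"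
    using Q N B by (simp add: vec power2_eq_square algebra_simps)
  have nz: "x0 \<noteq> 0" "d \<noteq> 0" "(1 + \<alpha>) *\<^sub>R d + n \<noteq> 0" "y1 \<noteq> 0"
  proof -
    show "x0 \<noteq> 0" using x0_norm Q by auto
    show "d \<noteq> 0" using d_norm D0 by auto
    show "(1 + \<alpha>) *\<^sub>R d + n \<noteq> 0" using r_norm s0 N by auto
    show "y1 \<noteq> 0" using N by (simp add: vec zero_prod_def)
  qed
  \<comment> \<open>Tightness of the constraint: the pair reduces the variances of \<open>Y1\<close>
    and \<open>X0\<close> by the same factor, so the two informations coincide.\<close>
  have "(norm y1 / norm ((1 + \<alpha>) *\<^sub>R d + n))\<^sup>2 = (norm x0 / norm d)\<^sup>2"
  proof -
    have "(B + N) * D = Q * N" using N B by (simp add: D_def)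
    then have "((1 + \<alpha>)\<^sup>2 * Q + B + N) * D = Q * (s + N)"
      by (simp add: s algebra_simps)
    then show ?thesis
      unfolding power_divide power2_norm_eq_inner y1_norm r_norm x0_norm d_norm
      using s0 N D0 by (simp add: frac_eq_eq)
  qed
  then have ratio: "norm y1 / norm ((1 + \<alpha>) *\<^sub>R d + n) = norm x0 / norm d"
    by (rule power2_eq_imp_eq) auto
  have MI: "mutual_info 2 (joint_law Q N p) (borel \<Otimes>\<^sub>M borel) borel (\<lambda>\<omega>. (W1 \<omega>, W2 \<omega>)) F =
      mutual_info 2 std_gaussian (borel \<Otimes>\<^sub>M borel) borel (\<lambda>z. (0 + w1 \<bullet> z, 0 + w2 \<bullet> z)) (\<lambda>z. F (\<phi> z))"
    if [measurable]: "F \<in> borel_measurable borel" for F :: "outcome \<Rightarrow> real"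
    unfolding J by (subst mutual_info_distr) (auto simp: W1 W2)
  have MI_Y: "mutual_info 2 (joint_law Q N p) (borel \<Otimes>\<^sub>M borel) borel (\<lambda>\<omega>. (W1 \<omega>, W2 \<omega>)) Y1 =
      ereal (log 2 (norm x0 / norm d))"
    unfolding ratio[symmetric]
    by (subst MI, simp, unfold Y1, rule mutual_info_gaussian_finite[OF y1d rw nz(4,3)]) simp
  have MI_X: "mutual_info 2 (joint_law Q N p) (borel \<Otimes>\<^sub>M borel) borel (\<lambda>\<omega>. (W1 \<omega>, W2 \<omega>)) X0 =
      ereal (log 2 (norm x0 / norm d))"
    by (subst MI, simp, unfold X0, rule mutual_info_gaussian_finite[OF x0d dw nz(1,2)]) simp
  have p: "p \<in> policies" unfolding p_def by (rule linear_policy_in_policies)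
  obtain PW1 KW2 KU1 KU2 where p_eq: "p = (PW1, KW2, KU1, KU2)" by (cases p)
  interpret policy_law Q N PW1 KW2 KU1 KU2
    by unfold_locales (use Q N p p_eq in auto)
  have CMI: "cond_mutual_info 2 (joint_law Q N p) borel borel borel W2 X0 W1 = ereal (log 2 (norm x0 / norm d))"
    unfolding MI_X[symmetric] p_eq by (rule cond_mutual_info_joint_law)

  have moment: "(\<integral>\<omega>. (F \<omega>)\<^sup>2 \<partial>joint_law Q N p) = f \<bullet> f"
    if F: "\<And>z. F (\<phi> z) = 0 + f \<bullet> z" and [measurable]: "F \<in> borel_measurable borel" for F :: "outcome \<Rightarrow> real" and f
    using std_gaussian_affine_moment[of 0 f 0 f] unfolding J
    by (subst integral_distr) (auto simp: F has_bochner_integral_iff power2_eq_square)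
  have "(\<integral>\<omega>. (U1 \<omega>)\<^sup>2 \<partial>joint_law Q N p) = (\<alpha> *\<^sub>R x0 + w1) \<bullet> (\<alpha> *\<^sub>R x0 + w1)"
    by (rule moment[OF U1]) simp
  also have "\<dots> = \<alpha>\<^sup>2 * Q + B" using Q B by (simp add: vec power2_eq_square)
  finally have "p \<in> gaussian_policies Q N (\<alpha>\<^sup>2 * Q + B)"
    using p gauss by (simp add: gaussian_policies_def Let_def MI_Y CMI)
  moreover have "(\<integral>\<omega>. (X1 \<omega> - U2 \<omega>)\<^sup>2 \<partial>joint_law Q N p) = est_cost Q N \<alpha> B"
  proof -
    let ?e = "((1 - g) * (1 + \<alpha>)) *\<^sub>R d - g *\<^sub>R n"
    have "(\<integral>\<omega>. (X1 \<omega> - U2 \<omega>)\<^sup>2 \<partial>joint_law Q N p) = ?e \<bullet> ?e"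
      by (rule moment[OF err]) simp
    also have "\<dots> = (1 - g)\<^sup>2 * s + g\<^sup>2 * N"
      using nv d_norm by (simp add: s inner_diff_left inner_diff_right power2_eq_square)
    also have "\<dots> = s * N / (s + N)" unfolding g_def by (rule mmse_identity[OF s0 N])
    finally show ?thesis by (simp add: est_cost_def s_def)
  qed
  ultimately show ?thesis by blast
qed

subsection \<open>Minimisation\<close>

text \<open>Clearing denominators leaves \<open>N\<close> times the square of
  \<open>P + N + \<alpha> * Q\<close>, which also shows where the bound is attained.\<close>

lemma est_cost_ge_linear:
  assumes Q: "Q > 0" and N: "N > 0" and B: "B \<ge> 0" and P: "\<alpha>\<^sup>2 * Q + B = P"
  shows "N * (Q - N - P) / Q \<le> est_cost Q N \<alpha> B"
proof -
  define s where "s = residual_var Q N \<alpha> B"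
  have R: "B + N = P + N - \<alpha>\<^sup>2 * Q" using P by simp
  have s: "s * (B + N) = (1 + \<alpha>)\<^sup>2 * Q * N" using B N by (simp add: s_def residual_var_def)
  have s0: "s \<ge> 0" using Q N B by (simp add: s_def residual_var_def)
  have "(s * (P + N)) * (B + N) - (N * (Q - N - P)) * (B + N) = N * (P + N + \<alpha> * Q)\<^sup>2"
  proof -
    have "(s * (P + N)) * (B + N) - (N * (Q - N - P)) * (B + N) =
        ((1 + \<alpha>)\<^sup>2 * Q * N) * (P + N) - (N * (Q - N - P)) * (P + N - \<alpha>\<^sup>2 * Q)"
      unfolding R[symmetric] s[symmetric] by (simp add: mult_ac)
    then show ?thesis by (simp add: power2_eq_square algebra_simps)
  qed
  then have "(N * (Q - N - P)) * (B + N) \<le> (s * (P + N)) * (B + N)"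
    using N by (smt (verit) mult_nonneg_nonneg zero_le_power2)
  then have "N * (Q - N - P) \<le> s * (P + N)" using N B by simp
  then have "N * (Q - N - P) * (s + N) \<le> (s * N) * Q"
    using mult_right_mono[of "N * (Q - N - P)" "s * (P + N)" N] N by (simp add: algebra_simps)
  then show ?thesis
    unfolding est_cost_def s_def[symmetric] using Q N s0 by (simp add: field_simps)
qed

text \<open>By monotonicity of the estimation error it suffices to bound the residual variance from
  below by its value at \<open>B = 0\<close> with \<open>\<alpha>\<close> negative.\<close>

lemma est_cost_ge_no_coding:
  assumes Q: "Q > 0" and N: "N > 0" and B: "B \<ge> 0" and P: "\<alpha>\<^sup>2 * Q + B = P" and PQ: "P \<le> Q"
    and c: "Q * P \<le> (P + N)\<^sup>2"
  shows "(sqrt Q - sqrt P)\<^sup>2 * N / ((sqrt Q - sqrt P)\<^sup>2 + N) \<le> est_cost Q N \<alpha> B"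
proof -
  define p q a where "p = sqrt P" and "q = sqrt Q" and "a = - \<alpha> * sqrt Q"
  have "\<alpha>\<^sup>2 * Q \<ge> 0" using Q by simp
  then have P0: "P \<ge> 0" using P B by linarith
  have pq: "0 \<le> p" "p \<le> q" "p\<^sup>2 = P" "q\<^sup>2 = Q" using P0 Q PQ by (auto simp: p_def q_def)
  have a2: "a\<^sup>2 = \<alpha>\<^sup>2 * Q" using Q by (simp add: a_def power_mult_distrib)
  then have "a\<^sup>2 \<le> p\<^sup>2" using P B pq by simp
  then have ap: "a \<le> p" using pq by (metis power2_le_imp_le)
  have "q * p \<le> P + N"
    by (rule power2_le_imp_le) (use c P0 N pq in \<open>auto simp: power_mult_distrib\<close>)
  \<comment> \<open>The square root of hypothesis \<open>c\<close>, in the form in which it makes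
    the factor below nonnegative.\<close>
  then have Nge: "p * (q - p) \<le> N" using pq by (simp add: algebra_simps power2_eq_square)
  have "q\<^sup>2 - 2 * q * a + a\<^sup>2 = (1 + \<alpha>)\<^sup>2 * Q"
    using Q by (simp add: a2 pq a_def q_def power2_eq_square algebra_simps)
  then have qa: "(q - a)\<^sup>2 = (1 + \<alpha>)\<^sup>2 * Q" by (simp add: power2_diff)
  \<comment> \<open>The difference to be bounded vanishes at \<open>a = p\<close>; dividing out
    \<open>p - a\<close> leaves a cofactor whose terms are visibly nonnegative.\<close>
  have "0 \<le> (p - a) * (q * (p - a) * (q - p) + (N - p * (q - p)) * ((q - a) + (q - p)))"
    using ap pq Nge by (intro mult_nonneg_nonneg add_nonneg_nonneg) auto
  also have "\<dots> = (q - a)\<^sup>2 * N - (q - p)\<^sup>2 * (p\<^sup>2 - a\<^sup>2 + N)"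
    by (simp add: power2_eq_square algebra_simps)
  also have "p\<^sup>2 - a\<^sup>2 + N = B + N" using P by (simp add: a2 pq)
  finally have "(q - p)\<^sup>2 * (B + N) \<le> (1 + \<alpha>)\<^sup>2 * Q * N"
    by (simp add: qa)
  then have "(q - p)\<^sup>2 \<le> residual_var Q N \<alpha> B"
    using N B by (simp add: residual_var_def pos_le_divide_eq)
  then show ?thesis
    unfolding est_cost_def p_def[symmetric] q_def[symmetric] by (intro mmse_mono N) auto
qed

section \<open>The critical interval and the value of the infimum\<close>

text \<open>\<open>P1\<close> and \<open>P2\<close> are the roots of
  \<open>(P + N)\<^sup>2 = Q * P\<close> in \<open>P\<close>; completing the square compares the
  distance from their midpoint with half their gap.\<close>

lemma mem_P1_P2_iff:
  assumes "Q > 4 * N" "N > 0"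
  shows "P \<in> {P1 Q N..P2 Q N} \<longleftrightarrow> (P + N)\<^sup>2 \<le> Q * P"
proof -
  have "Q\<^sup>2 - 4 * Q * N = Q * (Q - 4 * N)" by (simp add: power2_eq_square algebra_simps)
  then have disc: "Q\<^sup>2 - 4 * Q * N \<ge> 0" using assms by simp
  have "P \<in> {P1 Q N..P2 Q N} \<longleftrightarrow> \<bar>2 * P - (Q - 2 * N)\<bar> \<le> sqrt (Q\<^sup>2 - 4 * Q * N)"
    by (auto simp: P1_def P2_def abs_le_iff field_simps)
  also have "\<dots> \<longleftrightarrow> (2 * P - (Q - 2 * N))\<^sup>2 \<le> Q\<^sup>2 - 4 * Q * N"
    using disc by (metis abs_ge_zero power2_abs real_sqrt_le_iff real_sqrt_abs)
  also have "(2 * P - (Q - 2 * N))\<^sup>2 = Q\<^sup>2 - 4 * Q * N + 4 * ((P + N)\<^sup>2 - Q * P)"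
    by (simp add: power2_eq_square algebra_simps)
  also have "\<dots> \<le> Q\<^sup>2 - 4 * Q * N \<longleftrightarrow> (P + N)\<^sup>2 \<le> Q * P"
    by simp
  finally show ?thesis .
qed

text \<open>The infimum over policies becomes a minimum over pairs \<open>(\<alpha>, B)\<close>:
  each pair is attained by a policy, and each policy costs at least as much as some pair.\<close>

lemma S_G_eqI:
  assumes "Q > 0" "N > 0" and B: "B \<ge> 0" and P: "\<alpha>\<^sup>2 * Q + B = P"
    and min: "\<And>\<alpha>' B'. B' \<ge> 0 \<Longrightarrow> \<alpha>'\<^sup>2 * Q + B' = P \<Longrightarrow> est_cost Q N \<alpha> B \<le> est_cost Q N \<alpha>' B'"
  shows "S_G Q N P = est_cost Q N \<alpha> B"
  unfolding S_G_def
proof (rule cInf_eq_minimum)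
  show "est_cost Q N \<alpha> B \<in> (\<lambda>p. \<integral>\<omega>. (X1 \<omega> - U2 \<omega>)\<^sup>2 \<partial>joint_law Q N p) ` gaussian_policies Q N P"
    using est_cost_attained[OF assms(1,2) B, of \<alpha>] P by (force simp: image_iff)
  fix c assume "c \<in> (\<lambda>p. \<integral>\<omega>. (X1 \<omega> - U2 \<omega>)\<^sup>2 \<partial>joint_law Q N p) ` gaussian_policies Q N P"
  then obtain p where p: "p \<in> gaussian_policies Q N P" and c: "c = (\<integral>\<omega>. (X1 \<omega> - U2 \<omega>)\<^sup>2 \<partial>joint_law Q N p)"
    by blast
  obtain PW1 KW2 KU1 KU2 where p_eq: "p = (PW1, KW2, KU1, KU2)" by (cases p)
  interpret policy_law Q N PW1 KW2 KU1 KU2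
    by unfold_locales (use assms p p_eq in \<open>auto simp: gaussian_policies_def\<close>)
  have "gaussian_law J" "(\<integral>\<omega>. (U1 \<omega>)\<^sup>2 \<partial>J) = P"
    "mutual_info 2 J (borel \<Otimes>\<^sub>M borel) borel (\<lambda>\<omega>. (W1 \<omega>, W2 \<omega>)) Y1 - cond_mutual_info 2 J borel borel borel W2 X0 W1 \<ge> 0"
    using p by (auto simp: gaussian_policies_def Let_def p_eq)
  from est_cost_le[OF this] obtain \<alpha>' B' where "B' \<ge> 0" "\<alpha>'\<^sup>2 * Q + B' = P" "est_cost Q N \<alpha>' B' \<le> c"
    unfolding c p_eq by blast
  with min show "est_cost Q N \<alpha> B \<le> c" by force
qed

theorem mainTheorem1:
  fixes Q N P :: real
  assumes "Q > 0" and "N > 0" and "P \<ge> 0"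
  shows "S_G Q N P =
    (if Q > 4 * N \<and> P \<in> {P1 Q N..P2 Q N} then N * (Q - N - P) / Q else S_l Q N P)"
proof (cases "Q > 4 * N \<and> P \<in> {P1 Q N..P2 Q N}")
  case True
  \<comment> \<open>The zero of the square in the linear lower bound, with the leftover power as
    \<open>B\<close>.\<close>
  define \<alpha> B where "\<alpha> = - (P + N) / Q" and "B = P - (P + N)\<^sup>2 / Q"
  have M: "(P + N)\<^sup>2 \<le> Q * P" using True mem_P1_P2_iff[of N Q P] assms by simp
  then have B: "B \<ge> 0" using assms by (simp add: B_def field_simps)
  have P: "\<alpha>\<^sup>2 * Q + B = P" using assms by (simp add: \<alpha>_def B_def power2_eq_square field_simps)
  have "Q * P < Q * (P + N)" using assms by simp
  then have "(P + N) * (P + N) < Q * (P + N)" using M unfolding power2_eq_square by linarith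
  \<comment> \<open>Strictness keeps \<open>B + N\<close> positive in the factored form and allows
    \<open>Q - (P + N)\<close> to be cancelled.\<close>
  then have MQ: "P + N < Q" using assms by simp
  have BN: "B + N = (P + N) * (Q - (P + N)) / Q"
    using assms by (simp add: B_def power2_eq_square field_simps)
  have "(1 + \<alpha>)\<^sup>2 * Q = (Q - (P + N))\<^sup>2 / Q"
    using assms by (simp add: \<alpha>_def power2_eq_square field_simps)
  then have "residual_var Q N \<alpha> B = (Q - (P + N)) * N / (P + N)"
    unfolding residual_var_def BN using assms MQ by (simp add: power2_eq_square)
  moreover have "(Q - (P + N)) * N / (P + N) + N = Q * N / (P + N)"
    using assms by (simp add: field_simps)
  ultimately have "est_cost Q N \<alpha> B = (Q - (P + N)) * N / (P + N) * N / (Q * N / (P + N))"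
    by (simp only: est_cost_def)
  also have "\<dots> = N * (Q - (P + N)) / Q" using assms by simp
  finally have cost: "est_cost Q N \<alpha> B = N * (Q - N - P) / Q" by (simp add: diff_diff_eq add.commute)
  have "S_G Q N P = est_cost Q N \<alpha> B"
    using est_cost_ge_linear[OF assms(1,2)] by (intro S_G_eqI[OF assms(1,2) B P]) (simp add: cost)
  then show ?thesis using True cost by simp
next
  case False
  show ?thesis
  proof (cases "P \<le> Q")
    case PQ: True
    have c: "Q * P \<le> (P + N)\<^sup>2"
    proof (cases "Q > 4 * N")
      case True
      then show ?thesis using False mem_P1_P2_iff[OF True assms(2), of P] by linarith
    next
      case Q4: False
      \<comment> \<open>For \<open>Q \<le> 4 * N\<close> the critical inequality can never be
        strictly reversed, by this decomposition.\<close>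
      have "(P + N)\<^sup>2 - Q * P = (P - N)\<^sup>2 + (4 * N - Q) * P"
        by (simp add: power2_eq_square algebra_simps)
      moreover have "(4 * N - Q) * P \<ge> 0" using Q4 assms by simp
      ultimately show ?thesis using zero_le_power2[of "P - N"] by linarith
    qed
    \<comment> \<open>All power is spent on cancelling part of \<open>X0\<close>, leaving none for
      \<open>W1\<close>.\<close>
    define \<alpha> where "\<alpha> = - sqrt P / sqrt Q"
    have P: "\<alpha>\<^sup>2 * Q + 0 = P" using assms by (simp add: \<alpha>_def power_divide)
    have "(1 + \<alpha>)\<^sup>2 * Q = ((1 + \<alpha>) * sqrt Q)\<^sup>2" using assms by (simp add: power_mult_distrib)
    also have "(1 + \<alpha>) * sqrt Q = sqrt Q - sqrt P" using assms by (simp add: \<alpha>_def field_simps)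
    finally have "residual_var Q N \<alpha> 0 = (sqrt Q - sqrt P)\<^sup>2"
      using assms by (simp add: residual_var_def)
    then have cost: "est_cost Q N \<alpha> 0 = (sqrt Q - sqrt P)\<^sup>2 * N / ((sqrt Q - sqrt P)\<^sup>2 + N)"
      by (simp add: est_cost_def)
    have "S_G Q N P = est_cost Q N \<alpha> 0"
      using est_cost_ge_no_coding[OF assms(1,2) _ _ PQ c] by (intro S_G_eqI[OF assms(1,2) _ P]) (simp_all add: cost)
    then show ?thesis unfolding if_not_P[OF False] S_l_def using PQ assms cost by simp
  next
    case PQ: False
    \<comment> \<open>For \<open>P > Q\<close> the state \<open>X0\<close> can be cancelled
      completely; the excess power goes into \<open>W1\<close>, which the decoder knows.\<close>
    have cost: "est_cost Q N (- 1) (P - Q) = 0" by (simp add: est_cost_def residual_var_def)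
    have "S_G Q N P = est_cost Q N (- 1) (P - Q)"
    proof (rule S_G_eqI[OF assms(1,2)])
      fix \<alpha> B :: real assume "B \<ge> 0"
      then show "est_cost Q N (- 1) (P - Q) \<le> est_cost Q N \<alpha> B"
        unfolding cost using assms by (simp add: est_cost_def residual_var_def)
    qed (use PQ in auto)
    then show ?thesis unfolding if_not_P[OF False] S_l_def using PQ cost by simp
  qed
qed

end
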